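(* Let $\kappa:Q\to\mathrm{Aut}(X)$ be an isometric (respectively, unitary) representation of a Lie group $Q$ on a Banach (respectively, Hilbert) space $X$. Let $p:\mathcal{F}\to M$ be the bundle associated via $\kappa$ to a principal $Q$-bundle $\pi:\mathcal{R}\to M$. Then $p$ is canonically a continuous Banach (respectively, Hilbert) bundle.
   Context: $M$ is a finite dimensional smooth manifold. A representation $\kappa$ is a homomorphism into linear homeomorphisms such that $Q\times X\to X$, $(g,v)\mapsto\kappa(g)v$, is continuous. $\mathcal{F}=(\mathcal{R}\times X)/\simeq$, where $(r,v)\simeq(s,w)$ iff there is $g\in Q$ with $s=rg^{-1}$, $w=\kappa(g)v$. It carries the quotient topology with respect to $q:\mathcal{R}\times X\to\mathcal{F}$, and $p([(r,v)])=\pi(r)$. Given a principal bundle atlas $(U_\alpha,\phi_\alpha)_{\alpha}$, $\phi_\alpha:\pi^{-1}(U_\alpha)\to U_\alpha\times Q$, of $\mathcal{R}$, the canonically induced atlas of $\mathcal{F}$ consists of $\psi_\alpha:p^{-1}(U_\alpha)\to U_\alpha\times X$ with inverse $\psi_\alpha'(m,v)=q(\phi_\alpha^{-1}(m,e),v)$. A continuous Banach (Hilbert) bundle with fiber $X$ is a locally trivial bundle with an atlas of fiber-preserving homeomorphisms onto $U\times X$ whose transition functions $U_\alpha\cap U_\beta\to\mathrm{Aut}(X)$ are continuous for the strong operator topology, with a norm (scalar product) on each fiber, continuous on the total space, for which the bundle charts are fiberwise linear isometries (unitary maps). "Canonically" means that this structure is given by the canonically induced atlas, and that the atlases induced by any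 two principal bundle atlases in the differentiable structure of $\mathcal{R}$ are $C^0$-compatible. The norm (scalar product) on fibers is $\|[(r,v)]\|=\|v\|_X$ (respectively $([(r,v)],[(r,w)])_S=(v,w)_X$). *)

theory Defs
  imports "HOL-Analysis.Analysis" "HOL-Algebra.Group"
begin

section \<open>Smooth manifolds\<close>

text \<open>
  The model space is \<open>Euclidean_space n\<close> (sequences vanishing from index \<open>n\<close> on),
  rather than a type of class \<open>euclidean_space\<close>, because the latter excludes dimension 0 and hence
  discrete Lie groups. The sets \<open>S\<close> below are meant to be open in \<open>Euclidean_space n\<close>.
\<close>

definition partial_derivative :: "nat \<Rightarrow> ((nat \<Rightarrow> real) \<Rightarrow> real) \<Rightarrow> (nat \<Rightarrow> real) \<Rightarrow> real" where
  "partial_derivative i f x = deriv (\<lambda>t. f (x(i := t))) (x i)"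

primrec Ck_on :: "nat \<Rightarrow> nat \<Rightarrow> (nat \<Rightarrow> real) set \<Rightarrow> ((nat \<Rightarrow> real) \<Rightarrow> real) \<Rightarrow> bool" where
  "Ck_on 0 n S f \<longleftrightarrow> continuous_on S f"
| "Ck_on (Suc k) n S f \<longleftrightarrow> continuous_on S f \<and>
     (\<forall>i<n. (\<forall>x\<in>S. (\<lambda>t. f (x(i := t))) field_differentiable at (x i)) \<and>
            Ck_on k n S (partial_derivative i f))"

definition smooth_on :: "nat \<Rightarrow> (nat \<Rightarrow> real) set \<Rightarrow> ((nat \<Rightarrow> real) \<Rightarrow> (nat \<Rightarrow> real)) \<Rightarrow> bool" where
  "smooth_on n S f \<longleftrightarrow> (\<forall>k j. Ck_on k n S (\<lambda>x. f x j))"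

text \<open>The field \<open>charts\<close> is a smooth atlas representing the differentiable structure; it need not
  be maximal.\<close>

record 'a manifold =
  mtop :: "'a topology"
  mdim :: nat
  charts :: "('a set \<times> ('a \<Rightarrow> nat \<Rightarrow> real)) set"

abbreviation points :: "'a manifold \<Rightarrow> 'a set" where
  "points M \<equiv> topspace (mtop M)"

text \<open>Second countability (or paracompactness) is not imposed, so that manifolds in the sense of
  each of the usual conventions are covered.\<close>

definition smooth_manifold :: "'a manifold \<Rightarrow> bool" where
  "smooth_manifold M \<longleftrightarrow>
     Hausdorff_space (mtop M) \<and>
     (\<Union>(U, \<phi>) \<in> charts M. U) = points M \<and>
     (\<forall>(U, \<phi>) \<in> charts M.
        openin (mtop M) U \<and>
        openin (Euclidean_space (mdim M)) (\<phi> ` U) \<and>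
        homeomorphic_map (subtopology (mtop M) U)
          (subtopology (Euclidean_space (mdim M)) (\<phi> ` U)) \<phi>) \<and>
     (\<forall>(U, \<phi>) \<in> charts M. \<forall>(V, \<psi>) \<in> charts M.
        smooth_on (mdim M) (\<phi> ` (U \<inter> V)) (\<psi> \<circ> inv_into U \<phi>))"

definition smooth_map :: "'a manifold \<Rightarrow> 'b manifold \<Rightarrow> ('a \<Rightarrow> 'b) \<Rightarrow> bool" where
  "smooth_map M N f \<longleftrightarrow>
     continuous_map (mtop M) (mtop N) f \<and>
     (\<forall>(U, \<phi>) \<in> charts M. \<forall>(V, \<psi>) \<in> charts N.
        smooth_on (mdim M) (\<phi> ` {x \<in> U. f x \<in> V}) (\<psi> \<circ> f \<circ> inv_into U \<phi>))"

definition diffeomorphism :: "'a manifold \<Rightarrow> 'b manifold \<Rightarrow> ('a \<Rightarrow> 'b) \<Rightarrow> bool" where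
  "diffeomorphism M N f \<longleftrightarrow> smooth_map M N f \<and>
     (\<exists>g. smooth_map N M g \<and> (\<forall>x\<in>points M. g (f x) = x) \<and> (\<forall>y\<in>points N. f (g y) = y))"

definition open_submanifold :: "'a manifold \<Rightarrow> 'a set \<Rightarrow> 'a manifold" where
  "open_submanifold M W =
     \<lparr>mtop = subtopology (mtop M) W,
      mdim = mdim M,
      charts = {(U \<inter> W, \<phi>) |U \<phi>. (U, \<phi>) \<in> charts M}\<rparr>"

definition product_manifold :: "'a manifold \<Rightarrow> 'b manifold \<Rightarrow> ('a \<times> 'b) manifold" where
  "product_manifold M N =
     \<lparr>mtop = prod_topology (mtop M) (mtop N),
      mdim = mdim M + mdim N,
      charts = {(U \<times> V, \<lambda>(x, y) i. if i < mdim M then \<phi> x i else \<psi> y (i - mdim M)) |U \<phi> V \<psi>.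
                  (U, \<phi>) \<in> charts M \<and> (V, \<psi>) \<in> charts N}\<rparr>"


section \<open>Lie groups and principal bundles\<close>

record 'q lie_structure = "'q monoid" +
  lie_manifold :: "'q manifold"

definition lie_group :: "'q lie_structure \<Rightarrow> bool" where
  "lie_group Q \<longleftrightarrow>
     group Q \<and> smooth_manifold (lie_manifold Q) \<and> points (lie_manifold Q) = carrier Q \<and>
     smooth_map (product_manifold (lie_manifold Q) (lie_manifold Q)) (lie_manifold Q)
       (\<lambda>(g, h). g \<otimes>\<^bsub>Q\<^esub> h) \<and>
     smooth_map (lie_manifold Q) (lie_manifold Q) (\<lambda>g. inv\<^bsub>Q\<^esub> g)"

text \<open>\<open>pb_act r g\<close> is the right action, written \<open>r g\<close> in the literature.\<close>

record ('q, 'm, 'r) principal_structure =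
  pb_base :: "'m manifold"
  pb_total :: "'r manifold"
  pb_proj :: "'r \<Rightarrow> 'm"
  pb_act :: "'r \<Rightarrow> 'q \<Rightarrow> 'r"

definition pb_over :: "('q, 'm, 'r) principal_structure \<Rightarrow> 'm set \<Rightarrow> 'r set" where
  "pb_over P U = {r \<in> points (pb_total P). pb_proj P r \<in> U}"

definition principal_chart ::
  "'q lie_structure \<Rightarrow> ('q, 'm, 'r) principal_structure \<Rightarrow> 'm set \<Rightarrow> ('r \<Rightarrow> 'm \<times> 'q) \<Rightarrow> bool" where
  "principal_chart Q P U \<phi> \<longleftrightarrow>
     openin (mtop (pb_base P)) U \<and>
     diffeomorphism (open_submanifold (pb_total P) (pb_over P U))
       (product_manifold (open_submanifold (pb_base P) U) (lie_manifold Q)) \<phi> \<and>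
     (\<forall>r\<in>pb_over P U. fst (\<phi> r) = pb_proj P r) \<and>
     (\<forall>r\<in>pb_over P U. \<forall>g\<in>carrier Q. \<phi> (pb_act P r g) = (pb_proj P r, snd (\<phi> r) \<otimes>\<^bsub>Q\<^esub> g))"

definition principal_atlas ::
  "'q lie_structure \<Rightarrow> ('q, 'm, 'r) principal_structure \<Rightarrow> ('m set \<times> ('r \<Rightarrow> 'm \<times> 'q)) set \<Rightarrow> bool" where
  "principal_atlas Q P \<A> \<longleftrightarrow>
     (\<forall>(U, \<phi>) \<in> \<A>. principal_chart Q P U \<phi>) \<and> (\<Union>(U, \<phi>) \<in> \<A>. U) = points (pb_base P)"

definition principal_bundle :: "'q lie_structure \<Rightarrow> ('q, 'm, 'r) principal_structure \<Rightarrow> bool" where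
  "principal_bundle Q P \<longleftrightarrow>
     lie_group Q \<and> smooth_manifold (pb_base P) \<and> smooth_manifold (pb_total P) \<and>
     smooth_map (pb_total P) (pb_base P) (pb_proj P) \<and>
     pb_proj P ` points (pb_total P) = points (pb_base P) \<and>
     smooth_map (product_manifold (pb_total P) (lie_manifold Q)) (pb_total P)
       (\<lambda>(r, g). pb_act P r g) \<and>
     (\<forall>r\<in>points (pb_total P). pb_act P r \<one>\<^bsub>Q\<^esub> = r) \<and>
     (\<forall>r\<in>points (pb_total P). \<forall>g\<in>carrier Q. \<forall>h\<in>carrier Q.
        pb_act P (pb_act P r g) h = pb_act P r (g \<otimes>\<^bsub>Q\<^esub> h)) \<and>
     (\<forall>r\<in>points (pb_total P). \<forall>g\<in>carrier Q. pb_proj P (pb_act P r g) = pb_proj P r) \<and>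
     (\<exists>\<A>. principal_atlas Q P \<A>)"


section \<open>Banach and Hilbert spaces over the real or complex numbers\<close>

text \<open>
  Real and complex scalars are treated together: \<open>'k\<close> is an arbitrary type of class
  \<open>real_normed_field\<close>, which by the Gelfand--Mazur theorem means the field of real or
  of complex numbers. Completeness is part of the class \<open>banach\<close>.
\<close>

definition banach_space :: "('k::real_normed_field \<Rightarrow> 'x::banach \<Rightarrow> 'x) \<Rightarrow> bool" where
  "banach_space smul \<longleftrightarrow>
     vector_space smul \<and>
     (\<forall>t x. smul (of_real t) x = t *\<^sub>R x) \<and>
     (\<forall>c x. norm (smul c x) = norm c * norm x)"

lemma banach_space_scaleR: "banach_space (scaleR :: real \<Rightarrow> 'x::banach \<Rightarrow> 'x)"
  by (simp add: banach_space_def real_vector.vector_space_axioms)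

text \<open>The unique element with \<open>conjugate a * a = \<bar>a\<bar>\<^sup>2\<close> (and \<open>conjugate 0 = 0\<close>).\<close>

definition conjugate :: "'k::real_normed_field \<Rightarrow> 'k" where
  "conjugate a = of_real ((norm a)\<^sup>2) / a"

lemma conjugate_real: "conjugate (a::real) = a"
  by (simp add: conjugate_def power2_eq_square)

lemma conjugate_complex: "conjugate (z::complex) = cnj z"
proof (cases "z = 0")
  case False
  then show ?thesis
    unfolding conjugate_def complex_norm_square by (rule nonzero_mult_div_cancel_left)
qed (simp add: conjugate_def)

text \<open>Scalar products are conjugate-linear in the first and linear in the second argument.\<close>

definition hilbert_space ::
  "('k::real_normed_field \<Rightarrow> 'x::banach \<Rightarrow> 'x) \<Rightarrow> ('x \<Rightarrow> 'x \<Rightarrow> 'k) \<Rightarrow> bool" where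
  "hilbert_space smul ip \<longleftrightarrow>
     banach_space smul \<and>
     (\<forall>u v w. ip u (v + w) = ip u v + ip u w) \<and>
     (\<forall>u v w. ip (u + v) w = ip u w + ip v w) \<and>
     (\<forall>u v c. ip u (smul c v) = c * ip u v) \<and>
     (\<forall>u v. ip v u = conjugate (ip u v)) \<and>
     (\<forall>v. ip v v = of_real ((norm v)\<^sup>2))"

definition Aut :: "('k::real_normed_field \<Rightarrow> 'x::banach \<Rightarrow> 'x) \<Rightarrow> ('x \<Rightarrow>\<^sub>L 'x) set" where
  "Aut smul = {T. Vector_Spaces.linear smul smul (blinfun_apply T) \<and>
                   (\<exists>S. homeomorphism UNIV UNIV (blinfun_apply T) S)}"

definition Aut_group :: "('k::real_normed_field \<Rightarrow> 'x::banach \<Rightarrow> 'x) \<Rightarrow> ('x \<Rightarrow>\<^sub>L 'x) monoid" where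
  "Aut_group smul = \<lparr>carrier = Aut smul, mult = (o\<^sub>L), one = id_blinfun\<rparr>"

definition representation ::
  "'q lie_structure \<Rightarrow> ('k::real_normed_field \<Rightarrow> 'x::banach \<Rightarrow> 'x) \<Rightarrow> ('q \<Rightarrow> 'x \<Rightarrow>\<^sub>L 'x) \<Rightarrow> bool" where
  "representation Q smul \<kappa> \<longleftrightarrow>
     \<kappa> \<in> hom Q (Aut_group smul) \<and>
     continuous_map (prod_topology (mtop (lie_manifold Q)) euclidean) euclidean
       (\<lambda>(g, v). blinfun_apply (\<kappa> g) v)"

definition isometric_representation ::
  "'q lie_structure \<Rightarrow> ('k::real_normed_field \<Rightarrow> 'x::banach \<Rightarrow> 'x) \<Rightarrow> ('q \<Rightarrow> 'x \<Rightarrow>\<^sub>L 'x) \<Rightarrow> bool" where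
  "isometric_representation Q smul \<kappa> \<longleftrightarrow>
     representation Q smul \<kappa> \<and>
     (\<forall>g\<in>carrier Q. \<forall>v. norm (blinfun_apply (\<kappa> g) v) = norm v)"

definition unitary_representation ::
  "'q lie_structure \<Rightarrow> ('k::real_normed_field \<Rightarrow> 'x::banach \<Rightarrow> 'x) \<Rightarrow> ('x \<Rightarrow> 'x \<Rightarrow> 'k) \<Rightarrow>
     ('q \<Rightarrow> 'x \<Rightarrow>\<^sub>L 'x) \<Rightarrow> bool" where
  "unitary_representation Q smul ip \<kappa> \<longleftrightarrow>
     representation Q smul \<kappa> \<and>
     (\<forall>g\<in>carrier Q. \<forall>v w. ip (blinfun_apply (\<kappa> g) v) (blinfun_apply (\<kappa> g) w) = ip v w)"


section \<open>Continuous Banach and Hilbert bundles\<close>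

text \<open>The operations \<open>lb_add\<close> and \<open>lb_scale\<close> are only meaningful within a fibre;
  \<open>lb_zero m\<close> is the zero vector of the fibre over \<open>m\<close>.\<close>

record ('k, 'm, 'e) linear_bundle =
  lb_base :: "'m topology"
  lb_total :: "'e topology"
  lb_proj :: "'e \<Rightarrow> 'm"
  lb_add :: "'e \<Rightarrow> 'e \<Rightarrow> 'e"
  lb_scale :: "'k \<Rightarrow> 'e \<Rightarrow> 'e"
  lb_zero :: "'m \<Rightarrow> 'e"

definition lb_over :: "('k, 'm, 'e) linear_bundle \<Rightarrow> 'm set \<Rightarrow> 'e set" where
  "lb_over F U = {e \<in> topspace (lb_total F). lb_proj F e \<in> U}"

abbreviation fibre :: "('k, 'm, 'e) linear_bundle \<Rightarrow> 'm \<Rightarrow> 'e set" where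
  "fibre F m \<equiv> lb_over F {m}"

definition vector_space_on ::
  "'e set \<Rightarrow> ('e \<Rightarrow> 'e \<Rightarrow> 'e) \<Rightarrow> ('k::field \<Rightarrow> 'e \<Rightarrow> 'e) \<Rightarrow> 'e \<Rightarrow> bool" where
  "vector_space_on S add sc zero \<longleftrightarrow>
     zero \<in> S \<and>
     (\<forall>a\<in>S. \<forall>b\<in>S. add a b \<in> S) \<and>
     (\<forall>c. \<forall>a\<in>S. sc c a \<in> S) \<and>
     (\<forall>a\<in>S. \<forall>b\<in>S. \<forall>d\<in>S. add (add a b) d = add a (add b d)) \<and>
     (\<forall>a\<in>S. \<forall>b\<in>S. add a b = add b a) \<and>
     (\<forall>a\<in>S. add zero a = a) \<and>
     (\<forall>a\<in>S. \<exists>b\<in>S. add a b = zero) \<and>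
     (\<forall>c. \<forall>a\<in>S. \<forall>b\<in>S. sc c (add a b) = add (sc c a) (sc c b)) \<and>
     (\<forall>c d. \<forall>a\<in>S. sc (c + d) a = add (sc c a) (sc d a)) \<and>
     (\<forall>c d. \<forall>a\<in>S. sc c (sc d a) = sc (c * d) a) \<and>
     (\<forall>a\<in>S. sc 1 a = a)"

definition norm_on ::
  "'e set \<Rightarrow> ('e \<Rightarrow> 'e \<Rightarrow> 'e) \<Rightarrow> ('k::real_normed_field \<Rightarrow> 'e \<Rightarrow> 'e) \<Rightarrow> 'e \<Rightarrow> ('e \<Rightarrow> real) \<Rightarrow> bool" where
  "norm_on S add sc zero N \<longleftrightarrow>
     (\<forall>a\<in>S. 0 \<le> N a \<and> (N a = 0 \<longleftrightarrow> a = zero)) \<and>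
     (\<forall>c. \<forall>a\<in>S. N (sc c a) = norm c * N a) \<and>
     (\<forall>a\<in>S. \<forall>b\<in>S. N (add a b) \<le> N a + N b)"

definition scalar_product_on ::
  "'e set \<Rightarrow> ('e \<Rightarrow> 'e \<Rightarrow> 'e) \<Rightarrow> ('k::real_normed_field \<Rightarrow> 'e \<Rightarrow> 'e) \<Rightarrow> 'e \<Rightarrow> ('e \<Rightarrow> 'e \<Rightarrow> 'k) \<Rightarrow> bool" where
  "scalar_product_on S add sc zero h \<longleftrightarrow>
     (\<forall>a\<in>S. \<forall>b\<in>S. \<forall>d\<in>S. h a (add b d) = h a b + h a d) \<and>
     (\<forall>a\<in>S. \<forall>b\<in>S. \<forall>d\<in>S. h (add a b) d = h a d + h b d) \<and>
     (\<forall>c. \<forall>a\<in>S. \<forall>b\<in>S. h a (sc c b) = c * h a b) \<and>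
     (\<forall>a\<in>S. \<forall>b\<in>S. h b a = conjugate (h a b)) \<and>
     (\<forall>a\<in>S. a \<noteq> zero \<longrightarrow> (\<exists>t>0. h a a = of_real t))"

definition linear_bundle_chart ::
  "('k::real_normed_field \<Rightarrow> 'x::banach \<Rightarrow> 'x) \<Rightarrow> ('k, 'm, 'e) linear_bundle \<Rightarrow>
     'm set \<Rightarrow> ('e \<Rightarrow> 'm \<times> 'x) \<Rightarrow> bool" where
  "linear_bundle_chart smul F U \<psi> \<longleftrightarrow>
     openin (lb_base F) U \<and>
     homeomorphic_map (subtopology (lb_total F) (lb_over F U))
       (prod_topology (subtopology (lb_base F) U) euclidean) \<psi> \<and>
     (\<forall>e\<in>lb_over F U. fst (\<psi> e) = lb_proj F e) \<and>
     (\<forall>m\<in>U. \<forall>e\<in>fibre F m. \<forall>f\<in>fibre F m. snd (\<psi> (lb_add F e f)) = snd (\<psi> e) + snd (\<psi> f)) \<and>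
     (\<forall>m\<in>U. \<forall>c. \<forall>e\<in>fibre F m. snd (\<psi> (lb_scale F c e)) = smul c (snd (\<psi> e)))"

definition strongly_continuous_transition ::
  "('k::real_normed_field \<Rightarrow> 'x::banach \<Rightarrow> 'x) \<Rightarrow> ('k, 'm, 'e) linear_bundle \<Rightarrow>
     'm set \<times> ('e \<Rightarrow> 'm \<times> 'x) \<Rightarrow> 'm set \<times> ('e \<Rightarrow> 'm \<times> 'x) \<Rightarrow> bool" where
  "strongly_continuous_transition smul F = (\<lambda>(U, \<psi>) (V, \<theta>).
     \<exists>\<tau>. continuous_map (subtopology (lb_base F) (U \<inter> V))
           (subtopology strong_operator_topology (Aut smul)) \<tau> \<and>
         (\<forall>e\<in>lb_over F (U \<inter> V).
            \<theta> e = (lb_proj F e, blinfun_apply (\<tau> (lb_proj F e)) (snd (\<psi> e)))))"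

definition C0_compatible ::
  "('k::real_normed_field \<Rightarrow> 'x::banach \<Rightarrow> 'x) \<Rightarrow> ('k, 'm, 'e) linear_bundle \<Rightarrow>
     ('m set \<times> ('e \<Rightarrow> 'm \<times> 'x)) set \<Rightarrow> ('m set \<times> ('e \<Rightarrow> 'm \<times> 'x)) set \<Rightarrow> bool" where
  "C0_compatible smul F \<A> \<B> \<longleftrightarrow>
     (\<forall>c \<in> \<A> \<union> \<B>. \<forall>d \<in> \<A> \<union> \<B>. strongly_continuous_transition smul F c d)"

definition continuous_linear_bundle ::
  "('k::real_normed_field \<Rightarrow> 'x::banach \<Rightarrow> 'x) \<Rightarrow> ('k, 'm, 'e) linear_bundle \<Rightarrow>
     ('m set \<times> ('e \<Rightarrow> 'm \<times> 'x)) set \<Rightarrow> bool" where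
  "continuous_linear_bundle smul F \<A> \<longleftrightarrow>
     continuous_map (lb_total F) (lb_base F) (lb_proj F) \<and>
     (\<forall>m\<in>topspace (lb_base F).
        vector_space_on (fibre F m) (lb_add F) (lb_scale F) (lb_zero F m)) \<and>
     (\<Union>(U, \<psi>) \<in> \<A>. U) = topspace (lb_base F) \<and>
     (\<forall>(U, \<psi>) \<in> \<A>. linear_bundle_chart smul F U \<psi>) \<and>
     (\<forall>c\<in>\<A>. \<forall>d\<in>\<A>. strongly_continuous_transition smul F c d)"

definition continuous_banach_bundle ::
  "('k::real_normed_field \<Rightarrow> 'x::banach \<Rightarrow> 'x) \<Rightarrow> ('k, 'm, 'e) linear_bundle \<Rightarrow> ('e \<Rightarrow> real) \<Rightarrow>
     ('m set \<times> ('e \<Rightarrow> 'm \<times> 'x)) set \<Rightarrow> bool" where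
  "continuous_banach_bundle smul F N \<A> \<longleftrightarrow>
     continuous_linear_bundle smul F \<A> \<and>
     (\<forall>m\<in>topspace (lb_base F). norm_on (fibre F m) (lb_add F) (lb_scale F) (lb_zero F m) N) \<and>
     continuous_map (lb_total F) euclideanreal N \<and>
     (\<forall>(U, \<psi>) \<in> \<A>. \<forall>e\<in>lb_over F U. norm (snd (\<psi> e)) = N e)"

definition continuous_hilbert_bundle ::
  "('k::real_normed_field \<Rightarrow> 'x::banach \<Rightarrow> 'x) \<Rightarrow> ('x \<Rightarrow> 'x \<Rightarrow> 'k) \<Rightarrow>
     ('k, 'm, 'e) linear_bundle \<Rightarrow> ('e \<Rightarrow> 'e \<Rightarrow> 'k) \<Rightarrow>
     ('m set \<times> ('e \<Rightarrow> 'm \<times> 'x)) set \<Rightarrow> bool" where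
  "continuous_hilbert_bundle smul ip F h \<A> \<longleftrightarrow>
     continuous_linear_bundle smul F \<A> \<and>
     (\<forall>m\<in>topspace (lb_base F).
        scalar_product_on (fibre F m) (lb_add F) (lb_scale F) (lb_zero F m) h) \<and>
     continuous_map
       (subtopology (prod_topology (lb_total F) (lb_total F)) {(e, f). lb_proj F e = lb_proj F f})
       euclidean (\<lambda>(e, f). h e f) \<and>
     (\<forall>(U, \<psi>) \<in> \<A>. \<forall>m\<in>U. \<forall>e\<in>fibre F m. \<forall>f\<in>fibre F m. ip (snd (\<psi> e)) (snd (\<psi> f)) = h e f)"


section \<open>The associated bundle\<close>

definition assoc_rel ::
  "'q lie_structure \<Rightarrow> ('q, 'm, 'r) principal_structure \<Rightarrow> ('q \<Rightarrow> 'x \<Rightarrow>\<^sub>L 'x::banach) \<Rightarrow>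
     (('r \<times> 'x) \<times> ('r \<times> 'x)) set" where
  "assoc_rel Q P \<kappa> =
     {((r, v), (s, w)) |r v s w. r \<in> points (pb_total P) \<and>
        (\<exists>g\<in>carrier Q. s = pb_act P r (inv\<^bsub>Q\<^esub> g) \<and> w = blinfun_apply (\<kappa> g) v)}"

definition assoc_class ::
  "'q lie_structure \<Rightarrow> ('q, 'm, 'r) principal_structure \<Rightarrow> ('q \<Rightarrow> 'x \<Rightarrow>\<^sub>L 'x::banach) \<Rightarrow>
     'r \<times> 'x \<Rightarrow> ('r \<times> 'x) set" where
  "assoc_class Q P \<kappa> z = assoc_rel Q P \<kappa> `` {z}"

definition quotient_topology :: "'a topology \<Rightarrow> ('a \<Rightarrow> 'b) \<Rightarrow> 'b topology" where
  "quotient_topology T q =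
     topology (\<lambda>W. W \<subseteq> q ` topspace T \<and> openin T {z \<in> topspace T. q z \<in> W})"

lemma openin_quotient_topology:
  "openin (quotient_topology T q) W \<longleftrightarrow>
     W \<subseteq> q ` topspace T \<and> openin T {z \<in> topspace T. q z \<in> W}"
proof -
  let ?O = "\<lambda>W. W \<subseteq> q ` topspace T \<and> openin T {z \<in> topspace T. q z \<in> W}"
  have "istopology ?O"
    unfolding istopology_def
  proof (intro conjI allI impI)
    fix S W assume "?O S" "?O W"
    moreover have "{z \<in> topspace T. q z \<in> S \<inter> W} =
        {z \<in> topspace T. q z \<in> S} \<inter> {z \<in> topspace T. q z \<in> W}" by blast
    ultimately show "S \<inter> W \<subseteq> q ` topspace T" "openin T {z \<in> topspace T. q z \<in> S \<inter> W}"
      by auto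
  next
    fix K assume K: "\<forall>S\<in>K. ?O S"
    then show "\<Union>K \<subseteq> q ` topspace T" by blast
    have "{z \<in> topspace T. q z \<in> \<Union>K} = (\<Union>S\<in>K. {z \<in> topspace T. q z \<in> S})" by blast
    with K show "openin T {z \<in> topspace T. q z \<in> \<Union>K}" by auto
  qed
  then show ?thesis
    by (simp add: quotient_topology_def topology_inverse')
qed

lemma topspace_quotient_topology: "topspace (quotient_topology T q) = q ` topspace T"
proof
  show "topspace (quotient_topology T q) \<subseteq> q ` topspace T"
    using openin_topspace [of "quotient_topology T q"] unfolding openin_quotient_topology by (rule conjunct1)
  have "{z \<in> topspace T. q z \<in> q ` topspace T} = topspace T" by blast
  then have "openin (quotient_topology T q) (q ` topspace T)"
    unfolding openin_quotient_topology by (metis openin_topspace order_refl)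
  then show "q ` topspace T \<subseteq> topspace (quotient_topology T q)"
    by (rule openin_subset)
qed

lemma quotient_map_quotient_topology: "quotient_map T (quotient_topology T q) q"
  unfolding quotient_map_def topspace_quotient_topology openin_quotient_topology by blast

text \<open>
  The points of the associated bundle are the equivalence classes themselves. On classes
  \<open>[(r, v)]\<close> and \<open>[(r, w)]\<close> the operations are \<open>[(r, v)] + [(r, w)] = [(r, v + w)]\<close> and
  \<open>c [(r, v)] = [(r, c v)]\<close>, which as sets of pairs are as follows. In the definitions below,
  \<open>the_elem\<close> yields the common value of an expression over all representatives.
\<close>

definition assoc_bundle ::
  "'q lie_structure \<Rightarrow> ('q, 'm, 'r) principal_structure \<Rightarrow>
     ('k::real_normed_field \<Rightarrow> 'x::banach \<Rightarrow> 'x) \<Rightarrow> ('q \<Rightarrow> 'x \<Rightarrow>\<^sub>L 'x) \<Rightarrow>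
     ('k, 'm, ('r \<times> 'x) set) linear_bundle" where
  "assoc_bundle Q P smul \<kappa> =
     \<lparr>lb_base = mtop (pb_base P),
      lb_total = quotient_topology (prod_topology (mtop (pb_total P)) euclidean) (assoc_class Q P \<kappa>),
      lb_proj = (\<lambda>a. the_elem {pb_proj P r |r v. (r, v) \<in> a}),
      lb_add = (\<lambda>a b. {(r, v + w) |r v w. (r, v) \<in> a \<and> (r, w) \<in> b}),
      lb_scale = (\<lambda>c a. {(r, smul c v) |r v. (r, v) \<in> a}),
      lb_zero = (\<lambda>m. {(r, 0) |r. r \<in> pb_over P {m}})\<rparr>"

definition assoc_norm :: "('r \<times> 'x::banach) set \<Rightarrow> real" where
  "assoc_norm a = the_elem {norm v |r v. (r, v) \<in> a}"

definition assoc_scalar_product ::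
  "('x \<Rightarrow> 'x \<Rightarrow> 'k) \<Rightarrow> ('r \<times> 'x) set \<Rightarrow> ('r \<times> 'x) set \<Rightarrow> 'k" where
  "assoc_scalar_product ip a b = the_elem {ip v w |r v w. (r, v) \<in> a \<and> (r, w) \<in> b}"

definition assoc_chart_inv ::
  "'q lie_structure \<Rightarrow> ('q, 'm, 'r) principal_structure \<Rightarrow> ('q \<Rightarrow> 'x \<Rightarrow>\<^sub>L 'x::banach) \<Rightarrow>
     'm set \<Rightarrow> ('r \<Rightarrow> 'm \<times> 'q) \<Rightarrow> 'm \<times> 'x \<Rightarrow> ('r \<times> 'x) set" where
  "assoc_chart_inv Q P \<kappa> U \<phi> =
     (\<lambda>(m, v). assoc_class Q P \<kappa> (inv_into (pb_over P U) \<phi> (m, \<one>\<^bsub>Q\<^esub>), v))"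

definition assoc_chart ::
  "'q lie_structure \<Rightarrow> ('q, 'm, 'r) principal_structure \<Rightarrow> ('q \<Rightarrow> 'x \<Rightarrow>\<^sub>L 'x::banach) \<Rightarrow>
     'm set \<Rightarrow> ('r \<Rightarrow> 'm \<times> 'q) \<Rightarrow> ('r \<times> 'x) set \<Rightarrow> 'm \<times> 'x" where
  "assoc_chart Q P \<kappa> U \<phi> = inv_into (U \<times> UNIV) (assoc_chart_inv Q P \<kappa> U \<phi>)"

definition assoc_atlas ::
  "'q lie_structure \<Rightarrow> ('q, 'm, 'r) principal_structure \<Rightarrow> ('q \<Rightarrow> 'x \<Rightarrow>\<^sub>L 'x::banach) \<Rightarrow>
     ('m set \<times> ('r \<Rightarrow> 'm \<times> 'q)) set \<Rightarrow> ('m set \<times> (('r \<times> 'x) set \<Rightarrow> 'm \<times> 'x)) set" where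
  "assoc_atlas Q P \<kappa> \<A> = {(U, assoc_chart Q P \<kappa> U \<phi>) |U \<phi>. (U, \<phi>) \<in> \<A>}"

text \<open>
  \<open>canonically Q P smul \<kappa> B\<close>: the property \<open>B\<close> of an atlas holds for every canonically induced
  atlas, and all canonically induced atlases are mutually compatible. The first conjunct records
  that \<open>assoc_chart\<close>, defined with \<open>inv_into\<close>, is a genuine two-sided inverse.
\<close>

definition canonically ::
  "'q lie_structure \<Rightarrow> ('q, 'm, 'r) principal_structure \<Rightarrow>
     ('k::real_normed_field \<Rightarrow> 'x::banach \<Rightarrow> 'x) \<Rightarrow> ('q \<Rightarrow> 'x \<Rightarrow>\<^sub>L 'x) \<Rightarrow>
     (('m set \<times> (('r \<times> 'x) set \<Rightarrow> 'm \<times> 'x)) set \<Rightarrow> bool) \<Rightarrow> bool" where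
  "canonically Q P smul \<kappa> B \<longleftrightarrow>
     (let F = assoc_bundle Q P smul \<kappa> in
       (\<forall>\<A>. principal_atlas Q P \<A> \<longrightarrow>
          (\<forall>(U, \<phi>) \<in> \<A>.
             homeomorphic_maps
               (prod_topology (subtopology (lb_base F) U) euclidean)
               (subtopology (lb_total F) (lb_over F U))
               (assoc_chart_inv Q P \<kappa> U \<phi>) (assoc_chart Q P \<kappa> U \<phi>)) \<and>
          B (assoc_atlas Q P \<kappa> \<A>)) \<and>
       (\<forall>\<A> \<B>. principal_atlas Q P \<A> \<and> principal_atlas Q P \<B> \<longrightarrow>
          C0_compatible smul F (assoc_atlas Q P \<kappa> \<A>) (assoc_atlas Q P \<kappa> \<B>)))"

end

theory Submission
  imports Defs
begin

text \<open>
  A principal chart \<open>\<phi>\<close> shows that \<open>Q\<close> acts freely and transitively on the fibres of \<open>R\<close>. Hence a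
  choice of \<open>r\<close> over \<open>m\<close> identifies the fibre of the associated bundle over \<open>m\<close> with \<open>X\<close> via
  \<open>v \<mapsto> [(r, v)]\<close>, and all fibrewise structure is transported from \<open>X\<close>; independence of \<open>r\<close> is
  linearity and isometry (unitarity) of \<open>\<kappa>\<close>. In these terms the induced chart is
  \<open>[(r, v)] \<mapsto> (\<pi> r, \<kappa> (snd (\<phi> r)) v)\<close>, which is continuous because the quotient map restricts
  to a quotient map over open sets and \<open>\<kappa>\<close> is jointly continuous. The transition from \<open>\<phi>\<close> to
  \<open>\<theta>\<close> is \<open>m \<mapsto> \<kappa> (snd (\<theta> (\<sigma> m)))\<close>, where \<open>\<sigma> m = \<phi>\<inverse> (m, e)\<close>, and joint continuity of \<open>\<kappa>\<close> makes
  it strongly continuous.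
\<close>

locale principal_representation =
  fixes Q :: "'q lie_structure" (structure)
    and P :: "('q, 'm, 'r) principal_structure"
    and smul :: "'k::real_normed_field \<Rightarrow> 'x::banach \<Rightarrow> 'x"
    and \<kappa> :: "'q \<Rightarrow> 'x \<Rightarrow>\<^sub>L 'x"
  assumes principal: "principal_bundle Q P"
    and banach: "banach_space smul"
    and isometric: "isometric_representation Q smul \<kappa>"
begin

abbreviation "total_points \<equiv> points (pb_total P)"
abbreviation "assoc \<equiv> assoc_bundle Q P smul \<kappa>"
abbreviation "cls \<equiv> assoc_class Q P \<kappa>"
abbreviation "rep g \<equiv> blinfun_apply (\<kappa> g)"

section \<open>The right action and principal charts\<close>

lemma lie_group: "lie_group Q"
  using principal by (simp add: principal_bundle_def)

sublocale group Q
  using lie_group by (simp add: lie_group_def)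

lemma topspace_lie [simp]: "topspace (mtop (lie_manifold Q)) = carrier Q"
  using lie_group by (simp add: lie_group_def)

text \<open>Closure is not a separate clause of \<open>principal_bundle\<close>; it is extracted
  from continuity of the action, since a continuous map sends \<open>topspace\<close> into
  \<open>topspace\<close>.\<close>

lemma act_closed [simp]:
  assumes "r \<in> total_points" "g \<in> carrier Q"
  shows "pb_act P r g \<in> total_points"
proof -
  have "continuous_map (prod_topology (mtop (pb_total P)) (mtop (lie_manifold Q)))
     (mtop (pb_total P)) (\<lambda>(r, g). pb_act P r g)"
    using principal by (simp add: principal_bundle_def smooth_map_def product_manifold_def)
  from continuous_map_image_subset_topspace [OF this] show ?thesis
    using assms by (auto simp: image_subset_iff)
qed

lemma act_one [simp]: "r \<in> total_points \<Longrightarrow> pb_act P r \<one> = r"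
  using principal by (simp add: principal_bundle_def)

lemma act_act [simp]:
  "\<lbrakk>r \<in> total_points; g \<in> carrier Q; h \<in> carrier Q\<rbrakk>
    \<Longrightarrow> pb_act P (pb_act P r g) h = pb_act P r (g \<otimes> h)"
  using principal by (simp add: principal_bundle_def)

lemma proj_act [simp]:
  "\<lbrakk>r \<in> total_points; g \<in> carrier Q\<rbrakk> \<Longrightarrow> pb_proj P (pb_act P r g) = pb_proj P r"
  using principal by (simp add: principal_bundle_def)

lemma proj_image: "pb_proj P ` total_points = points (pb_base P)"
  using principal by (simp add: principal_bundle_def)

lemma continuous_proj: "continuous_map (mtop (pb_total P)) (mtop (pb_base P)) (pb_proj P)"
  using principal by (simp add: principal_bundle_def smooth_map_def)

lemma ex_chart:
  assumes "m \<in> points (pb_base P)"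
  obtains U \<phi> where "principal_chart Q P U \<phi>" "m \<in> U"
proof -
  obtain \<A> where "principal_atlas Q P \<A>"
    using principal by (auto simp: principal_bundle_def)
  then have "\<forall>(U, \<phi>) \<in> \<A>. principal_chart Q P U \<phi>" "m \<in> (\<Union>(U, \<phi>) \<in> \<A>. U)"
    using assms by (auto simp: principal_atlas_def)
  with that show ?thesis
    by fast
qed

text \<open>\<open>diffeomorphism\<close> provides some inverse, whereas the induced charts are
  defined with \<open>inv_into\<close>. The two agree on the target because \<open>\<phi>\<close> is
  injective.\<close>

lemma chart_homeomorphic_maps:
  assumes "principal_chart Q P U \<phi>"
  shows "homeomorphic_maps (subtopology (mtop (pb_total P)) (pb_over P U))
    (prod_topology (subtopology (mtop (pb_base P)) U) (mtop (lie_manifold Q)))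
    \<phi> (inv_into (pb_over P U) \<phi>)"
proof -
  let ?X = "subtopology (mtop (pb_total P)) (pb_over P U)"
  let ?Y = "prod_topology (subtopology (mtop (pb_base P)) U) (mtop (lie_manifold Q))"
  have "diffeomorphism (open_submanifold (pb_total P) (pb_over P U))
       (product_manifold (open_submanifold (pb_base P) U) (lie_manifold Q)) \<phi>"
    using assms by (simp add: principal_chart_def)
  then obtain \<theta> where \<theta>: "homeomorphic_maps ?X ?Y \<phi> \<theta>"
    by (auto simp: diffeomorphism_def smooth_map_def open_submanifold_def product_manifold_def
        homeomorphic_maps_def)
  have top: "topspace ?X = pb_over P U"
    by (auto simp: pb_over_def)
  have inj: "inj_on \<phi> (pb_over P U)"
    using \<theta> top by (metis homeomorphic_imp_injective_map homeomorphic_maps_map)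
  have "inv_into (pb_over P U) \<phi> y = \<theta> y" if "y \<in> topspace ?Y" for y
  proof -
    have "\<theta> y \<in> pb_over P U" "\<phi> (\<theta> y) = y"
      using \<theta> that top unfolding homeomorphic_maps_def
      by (metis continuous_map_image_subset_topspace image_subset_iff, blast)
    then show ?thesis
      using inj by (metis inv_into_f_f)
  qed
  with \<theta> show ?thesis
    by (subst homeomorphic_maps_eq [where f = \<phi> and g = \<theta>]) auto
qed

lemma openin_chart: "principal_chart Q P U \<phi> \<Longrightarrow> openin (mtop (pb_base P)) U"
  by (simp add: principal_chart_def)

lemma chart_domain:
  assumes "principal_chart Q P U \<phi>"
  shows "U \<subseteq> points (pb_base P)"
  using openin_chart [OF assms] by (rule openin_subset)

lemma fst_chart:
  assumes "principal_chart Q P U \<phi>" "r \<in> total_points" "pb_proj P r \<in> U"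
  shows "fst (\<phi> r) = pb_proj P r"
  using assms by (auto simp: principal_chart_def pb_over_def)

lemma snd_chart_closed:
  assumes "principal_chart Q P U \<phi>" "r \<in> total_points" "pb_proj P r \<in> U"
  shows "snd (\<phi> r) \<in> carrier Q"
proof -
  have "\<phi> r \<in> topspace (prod_topology (subtopology (mtop (pb_base P)) U) (mtop (lie_manifold Q)))"
    using chart_homeomorphic_maps [OF assms(1)] assms(2,3)
    unfolding homeomorphic_maps_def
    by (auto dest!: continuous_map_image_subset_topspace simp: pb_over_def image_subset_iff)
  then show ?thesis
    by auto
qed

lemma snd_chart_act:
  assumes "principal_chart Q P U \<phi>" "r \<in> total_points" "pb_proj P r \<in> U" "g \<in> carrier Q"
  shows "snd (\<phi> (pb_act P r g)) = snd (\<phi> r) \<otimes> g"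
  using assms by (auto simp: principal_chart_def pb_over_def)

text \<open>Base point and group coordinate together are the value of the chart, which is injective.
  Equalities between points of the total space are reduced to this criterion below.\<close>

lemma chart_inj:
  assumes "principal_chart Q P U \<phi>" "r \<in> total_points" "s \<in> total_points"
    "pb_proj P r \<in> U" "pb_proj P s = pb_proj P r" "snd (\<phi> r) = snd (\<phi> s)"
  shows "r = s"
proof -
  have "\<phi> r = \<phi> s"
    using assms by (metis fst_chart prod_eqI)
  moreover have "inv_into (pb_over P U) \<phi> (\<phi> r) = r" "inv_into (pb_over P U) \<phi> (\<phi> s) = s"
    using chart_homeomorphic_maps [OF assms(1)] assms
    by (auto simp: homeomorphic_maps_def pb_over_def)
  ultimately show ?thesis
    by metis
qed

section \<open>Freeness and fibrewise transitivity of the action\<close>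

lemma act_free:
  assumes "r \<in> total_points" "g \<in> carrier Q" "h \<in> carrier Q" "pb_act P r g = pb_act P r h"
  shows "g = h"
proof -
  have "pb_proj P r \<in> points (pb_base P)"
    using assms(1) proj_image by blast
  then obtain U \<phi> where "principal_chart Q P U \<phi>" "pb_proj P r \<in> U"
    by (rule ex_chart)
  \<comment> \<open>By equivariance \<open>snd (\<phi> r) \<otimes> g\<close> and
    \<open>snd (\<phi> r) \<otimes> h\<close> are group coordinates of the same point; cancel on the
    left.\<close>
  with assms show ?thesis
    by (metis snd_chart_act snd_chart_closed Units_l_cancel Units_eq)
qed

lemma act_transitive:
  assumes "r \<in> total_points" "s \<in> total_points" "pb_proj P s = pb_proj P r"
  obtains g where "g \<in> carrier Q" "s = pb_act P r g"
proof -
  have "pb_proj P r \<in> points (pb_base P)"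
    using assms(1) proj_image by blast
  then obtain U \<phi> where c: "principal_chart Q P U \<phi>" and U: "pb_proj P r \<in> U"
    by (rule ex_chart)
  \<comment> \<open>Solves \<open>snd (\<phi> r) \<otimes> g = snd (\<phi> s)\<close>, so that
    \<open>pb_act P r g\<close> and \<open>s\<close> get the same group coordinate.\<close>
  define g where "g = inv (snd (\<phi> r)) \<otimes> snd (\<phi> s)"
  have cl: "snd (\<phi> r) \<in> carrier Q" "snd (\<phi> s) \<in> carrier Q"
    using c U assms by (auto intro: snd_chart_closed)
  then have g: "g \<in> carrier Q"
    by (simp add: g_def)
  have "snd (\<phi> (pb_act P r g)) = snd (\<phi> s)"
    using c U assms g cl by (simp add: snd_chart_act) (simp add: g_def flip: m_assoc)
  then have "pb_act P r g = s"
    using c U assms g by (intro chart_inj [OF c]) auto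
  with g that show ?thesis
    by blast
qed

section \<open>Local sections of principal charts\<close>

definition local_section :: "'m set \<Rightarrow> ('r \<Rightarrow> 'm \<times> 'q) \<Rightarrow> 'm \<Rightarrow> 'r" where
  "local_section U \<phi> m = inv_into (pb_over P U) \<phi> (m, \<one>)"

lemma continuous_local_section:
  assumes "principal_chart Q P U \<phi>"
  shows "continuous_map (subtopology (mtop (pb_base P)) U)
    (subtopology (mtop (pb_total P)) (pb_over P U)) (local_section U \<phi>)"
proof -
  have "continuous_map (subtopology (mtop (pb_base P)) U)
      (prod_topology (subtopology (mtop (pb_base P)) U) (mtop (lie_manifold Q))) (\<lambda>m. (m, \<one>))"
    by (intro continuous_map_pairedI) auto
  moreover have "continuous_map
      (prod_topology (subtopology (mtop (pb_base P)) U) (mtop (lie_manifold Q)))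
      (subtopology (mtop (pb_total P)) (pb_over P U)) (inv_into (pb_over P U) \<phi>)"
    using chart_homeomorphic_maps [OF assms] by (simp add: homeomorphic_maps_def)
  ultimately show ?thesis
    unfolding local_section_def by (rule continuous_map_compose [unfolded o_def])
qed

lemma local_section:
  assumes "principal_chart Q P U \<phi>" "m \<in> U"
  shows local_section_closed: "local_section U \<phi> m \<in> total_points"
    and proj_local_section: "pb_proj P (local_section U \<phi> m) = m"
    and snd_chart_local_section: "snd (\<phi> (local_section U \<phi> m)) = \<one>"
proof -
  have m: "m \<in> topspace (subtopology (mtop (pb_base P)) U)"
    using assms chart_domain by auto
  have over: "local_section U \<phi> m \<in> topspace (subtopology (mtop (pb_total P)) (pb_over P U))"
    using continuous_local_section [OF assms(1)] m
    by (metis continuous_map_image_subset_topspace image_subset_iff)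
  from over show s: "local_section U \<phi> m \<in> total_points"
    by simp
  have *: "pb_proj P (local_section U \<phi> m) \<in> U"
    using over by (simp add: pb_over_def)
  have eq: "\<phi> (local_section U \<phi> m) = (m, \<one>)"
    using chart_homeomorphic_maps [OF assms(1)] m
    by (auto simp: homeomorphic_maps_def local_section_def)
  then show "snd (\<phi> (local_section U \<phi> m)) = \<one>"
    by simp
  show "pb_proj P (local_section U \<phi> m) = m"
    using fst_chart [OF assms(1) s *] eq by simp
qed

text \<open>Both points lie over the same base point, and equivariance gives the left side the group
  coordinate \<open>\<one> \<otimes> snd (\<phi> r)\<close>, which is that of
  \<open>r\<close>.\<close>

lemma act_local_section:
  assumes c: "principal_chart Q P U \<phi>" and r: "r \<in> total_points" and U: "pb_proj P r \<in> U"
  shows "pb_act P (local_section U \<phi> (pb_proj P r)) (snd (\<phi> r)) = r"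
proof -
  note s = local_section [OF c U] and g = snd_chart_closed [OF c r U]
  show ?thesis
    using s g U r by (intro chart_inj [OF c]) (auto simp: snd_chart_act [OF c])
qed

section \<open>Properties of the representation\<close>

lemma representation: "representation Q smul \<kappa>"
  using isometric by (simp add: isometric_representation_def)

lemma rep_Aut: "g \<in> carrier Q \<Longrightarrow> \<kappa> g \<in> Aut smul"
  using representation by (auto simp: representation_def hom_def Aut_group_def)

lemma rep_linear: "g \<in> carrier Q \<Longrightarrow> Vector_Spaces.linear smul smul (rep g)"
  using rep_Aut by (auto simp: Aut_def)

lemma rep_scale [simp]: "g \<in> carrier Q \<Longrightarrow> rep g (smul c v) = smul c (rep g v)"
  using rep_linear by (meson module_hom.scale Vector_Spaces.linear.axioms(3) linear_iff_module_hom)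

lemma rep_mult [simp]:
  "\<lbrakk>g \<in> carrier Q; h \<in> carrier Q\<rbrakk> \<Longrightarrow> rep (g \<otimes> h) v = rep g (rep h v)"
  using representation by (auto simp: representation_def hom_def Aut_group_def)

lemma norm_rep [simp]: "g \<in> carrier Q \<Longrightarrow> norm (rep g v) = norm v"
  using isometric by (simp add: isometric_representation_def)

text \<open>\<open>hom\<close> asks only for products to be preserved, which makes
  \<open>\<kappa> \<one>\<close> idempotent. Hence it annihilates \<open>rep \<one> v - v\<close>,
  and an isometry has trivial kernel.\<close>

lemma rep_one [simp]: "rep \<one> v = v"
proof -
  have "rep \<one> (rep \<one> v - v) = 0"
    by (simp add: blinfun.diff_right flip: rep_mult)
  then have "norm (rep \<one> v - v) = 0"
    by (metis norm_rep norm_zero one_closed)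
  then show ?thesis
    by simp
qed

lemma rep_inv_rep [simp]: "g \<in> carrier Q \<Longrightarrow> rep (inv g) (rep g v) = v"
  by (simp flip: rep_mult)

lemma continuous_rep:
  assumes "continuous_map X (mtop (lie_manifold Q)) f" "continuous_map X euclidean h"
  shows "continuous_map X euclidean (\<lambda>x. rep (f x) (h x))"
proof -
  have "continuous_map (prod_topology (mtop (lie_manifold Q)) euclidean) euclidean
       (\<lambda>(g, v). rep g v)"
    using representation by (simp add: representation_def)
  from continuous_map_compose [OF continuous_map_pairedI [OF assms] this]
  show ?thesis
    by (simp add: o_def)
qed

section \<open>Equivalence classes and their representatives\<close>

lemma class_eq:
  assumes "r \<in> total_points"
  shows "cls (r, v) = {(pb_act P r g, rep (inv g) v) |g. g \<in> carrier Q}"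
  \<comment> \<open>\<open>assoc_rel\<close> moves the point by an inverse; substituting
    \<open>inv g\<close> for \<open>g\<close> puts it in the form \<open>pb_act P r g\<close>, to
    which freeness applies.\<close>
  using assms unfolding assoc_class_def assoc_rel_def by auto (metis inv_closed inv_inv)+

text \<open>Moving a group element from the point to the vector only reparametrises the orbit:
  \<open>h\<close> becomes \<open>g \<otimes> h\<close>, and left translation by \<open>g\<close>
  permutes the group.\<close>

lemma class_act:
  assumes r: "r \<in> total_points" and g: "g \<in> carrier Q"
  shows "cls (pb_act P r g, v) = cls (r, rep g v)"
proof -
  have *: "(pb_act P (pb_act P r g) h, rep (inv h) v) =
     (pb_act P r (g \<otimes> h), rep (inv (g \<otimes> h)) (rep g v))" if "h \<in> carrier Q" for h
    using that r g by (simp add: inv_mult_group)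
  have "cls (pb_act P r g, v) =
      (\<lambda>h. (pb_act P r h, rep (inv h) (rep g v))) ` (\<lambda>h. g \<otimes> h) ` carrier Q"
    using r g unfolding image_image
    by (simp only: class_eq act_closed Setcompr_eq_image) (rule image_cong [OF refl *])
  also have "(\<lambda>h. g \<otimes> h) ` carrier Q = carrier Q"
    using g by (rule surj_const_mult)
  finally show ?thesis
    using r by (simp add: class_eq Setcompr_eq_image)
qed

lemma mem_class:
  assumes "r \<in> total_points"
  shows "(s, w) \<in> cls (r, v) \<longleftrightarrow> (\<exists>g\<in>carrier Q. s = pb_act P r g \<and> w = rep (inv g) v)"
  using assms by (auto simp: class_eq)

lemma self_mem_class: "r \<in> total_points \<Longrightarrow> (r, v) \<in> cls (r, v)"
  by (force simp: mem_class intro: bexI [of _ \<one>])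

text \<open>By freeness only \<open>\<one>\<close> fixes \<open>r\<close>, so a class contains no
  two pairs with the same first entry \<open>r\<close>.\<close>

lemma class_inject [simp]:
  assumes "r \<in> total_points"
  shows "cls (r, v) = cls (r, w) \<longleftrightarrow> v = w"
proof
  assume "cls (r, v) = cls (r, w)"
  then have "(r, v) \<in> cls (r, w)"
    using self_mem_class [OF assms] by auto
  then obtain g where g: "g \<in> carrier Q" "r = pb_act P r g" "v = rep (inv g) w"
    using assms by (auto simp: mem_class)
  then have "g = \<one>"
    using assms by (metis act_free act_one one_closed)
  with g show "v = w"
    by simp
qed simp

section \<open>Fibrewise structure of the associated bundle\<close>

lemma topspace_assoc: "topspace (lb_total assoc) = {cls (r, v) |r v. r \<in> total_points}"
  by (auto simp: assoc_bundle_def topspace_quotient_topology)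

lemma lb_base_assoc [simp]: "lb_base assoc = mtop (pb_base P)"
  by (simp add: assoc_bundle_def)

text \<open>All representatives have the same projection and \<open>self_mem_class\<close> makes the
  set of values nonempty, so \<open>the_elem\<close> is applied to a singleton.\<close>

lemma proj_class [simp]:
  assumes "r \<in> total_points"
  shows "lb_proj assoc (cls (r, v)) = pb_proj P r"
proof -
  have "{pb_proj P s |s w. (s, w) \<in> cls (r, v)} = {pb_proj P r}"
    using assms self_mem_class [OF assms, of v] by (force simp: class_eq)
  then show ?thesis
    by (simp add: assoc_bundle_def)
qed

lemma assoc_norm_class [simp]:
  assumes "r \<in> total_points"
  shows "assoc_norm (cls (r, v)) = norm v"
proof -
  have "{norm w |s w. (s, w) \<in> cls (r, v)} = {norm v}"
    using assms self_mem_class [OF assms, of v] by (force simp: class_eq)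
  then show ?thesis
    by (simp add: assoc_norm_def)
qed

text \<open>Since the action is free, representatives of two classes over the same \<open>s\<close> involve
  the same group element.\<close>

lemma class_common_act:
  assumes "r \<in> total_points"
  shows "(s, x) \<in> cls (r, v) \<and> (s, y) \<in> cls (r, w) \<longleftrightarrow>
    (\<exists>g\<in>carrier Q. s = pb_act P r g \<and> x = rep (inv g) v \<and> y = rep (inv g) w)"
  using assms by (auto simp: mem_class dest: act_free)

lemma add_class [simp]:
  assumes "r \<in> total_points"
  shows "lb_add assoc (cls (r, v)) (cls (r, w)) = cls (r, v + w)"
proof -
  have "lb_add assoc (cls (r, v)) (cls (r, w)) =
    {(s, x + y) |s x y. (s, x) \<in> cls (r, v) \<and> (s, y) \<in> cls (r, w)}"
    by (simp add: assoc_bundle_def)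
  also have "\<dots> = cls (r, v + w)"
    unfolding class_common_act [OF assms] using assms
    by (auto simp: class_eq blinfun.add_right)
  finally show ?thesis .
qed

lemma scale_class [simp]:
  assumes "r \<in> total_points"
  shows "lb_scale assoc c (cls (r, v)) = cls (r, smul c v)"
  using assms by (fastforce simp: assoc_bundle_def class_eq)

text \<open>By transitivity the points over one base point form a single orbit, and every
  \<open>rep g\<close> fixes \<open>0\<close>, so the set defining \<open>lb_zero\<close> is a
  single class.\<close>

lemma zero_class:
  assumes "r \<in> total_points"
  shows "lb_zero assoc (pb_proj P r) = cls (r, 0)"
  using assms
  by (auto simp: assoc_bundle_def pb_over_def class_eq blinfun.zero_right elim: act_transitive)

lemma over_iff:
  "e \<in> lb_over assoc U \<longleftrightarrow> (\<exists>r v. r \<in> total_points \<and> pb_proj P r \<in> U \<and> e = cls (r, v))"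
  by (auto simp: lb_over_def topspace_assoc)

text \<open>Transitivity writes the point of any representative as \<open>pb_act P r g\<close>, and
  \<open>class_act\<close> absorbs \<open>g\<close> into the vector.\<close>

lemma fibre_eq:
  assumes "r \<in> total_points"
  shows "fibre assoc (pb_proj P r) = range (\<lambda>v. cls (r, v))"
proof -
  have "e \<in> range (\<lambda>v. cls (r, v))" if "e \<in> fibre assoc (pb_proj P r)" for e
  proof -
    obtain s v where s: "s \<in> total_points" "pb_proj P s = pb_proj P r" "e = cls (s, v)"
      using \<open>e \<in> _\<close> by (auto simp: over_iff)
    then obtain g where "g \<in> carrier Q" "s = pb_act P r g"
      using act_transitive assms by metis
    with s assms show ?thesis
      by (auto simp: class_act)
  qed
  moreover have "range (\<lambda>v. cls (r, v)) \<subseteq> fibre assoc (pb_proj P r)"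
    using assms by (force simp: over_iff)
  ultimately show ?thesis
    by blast
qed

text \<open>An elimination rule that fixes one \<open>r\<close> over \<open>m\<close>, after which
  statements about the fibre become statements about vectors of \<open>X\<close>.\<close>

lemma fibre_induct:
  assumes "m \<in> points (pb_base P)"
    and "\<And>r. \<lbrakk>r \<in> total_points; m = pb_proj P r; fibre assoc m = range (\<lambda>v. cls (r, v));
      lb_zero assoc m = cls (r, 0)\<rbrakk> \<Longrightarrow> thesis"
  shows thesis
proof -
  obtain r where "r \<in> total_points" "m = pb_proj P r"
    using assms(1) proj_image by auto
  then show thesis
    using assms(2) by (simp add: fibre_eq zero_class)
qed

lemma vector_space_smul: "vector_space smul"
  using banach by (simp add: banach_space_def)

lemma norm_smul: "norm (smul c v) = norm c * norm v"
  using banach by (simp add: banach_space_def)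

lemma vector_space_on_fibre:
  assumes "m \<in> points (pb_base P)"
  shows "vector_space_on (fibre assoc m) (lb_add assoc) (lb_scale assoc) (lb_zero assoc m)"
proof -
  interpret vector_space smul
    by (rule vector_space_smul)
  obtain r where r: "r \<in> total_points" and [simp]: "fibre assoc m = range (\<lambda>v. cls (r, v))"
      "lb_zero assoc m = cls (r, 0)"
    using assms by (rule fibre_induct)
  show ?thesis
    unfolding vector_space_on_def using r
    \<comment> \<open>The witness \<open>- v\<close> represents the additive inverse of the class of
      \<open>(r, v)\<close>.\<close>
    by (auto simp: add_ac scale_right_distrib scale_left_distrib intro: exI [of _ "- v" for v])
qed

lemma norm_on_fibre:
  assumes "m \<in> points (pb_base P)"
  shows "norm_on (fibre assoc m) (lb_add assoc) (lb_scale assoc) (lb_zero assoc m) assoc_norm"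
proof -
  obtain r where "r \<in> total_points" "fibre assoc m = range (\<lambda>v. cls (r, v))"
      "lb_zero assoc m = cls (r, 0)"
    using assms by (rule fibre_induct)
  then show ?thesis
    by (auto simp: norm_on_def norm_smul norm_triangle_ineq)
qed

section \<open>Topology of the total space\<close>

lemma quotient_map_class:
  "quotient_map (prod_topology (mtop (pb_total P)) euclidean) (lb_total assoc) cls"
  by (simp add: assoc_bundle_def quotient_map_quotient_topology)

text \<open>Universal property of the quotient: continuity is tested on representatives.\<close>

lemma continuous_map_from_assoc:
  assumes "continuous_map (prod_topology (mtop (pb_total P)) euclidean) Y f"
    and "\<And>r v. r \<in> total_points \<Longrightarrow> g (cls (r, v)) = f (r, v)"
  shows "continuous_map (lb_total assoc) Y g"
  by (rule continuous_compose_quotient_map [OF quotient_map_class])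
    (rule continuous_map_eq [OF assms(1)], use assms(2) in auto)

lemma continuous_assoc_proj: "continuous_map (lb_total assoc) (mtop (pb_base P)) (lb_proj assoc)"
  by (rule continuous_map_from_assoc [where f = "pb_proj P \<circ> fst"])
    (auto intro: continuous_map_compose continuous_map_fst continuous_proj)

lemma continuous_assoc_norm: "continuous_map (lb_total assoc) euclideanreal assoc_norm"
  by (rule continuous_map_from_assoc [where f = "norm \<circ> snd"])
    (auto intro!: continuous_map_compose [OF continuous_map_snd] continuous_on_norm_id)

lemma openin_over:
  assumes "openin (mtop (pb_base P)) U"
  shows "openin (lb_total assoc) (lb_over assoc U)"
  unfolding lb_over_def by (rule openin_continuous_map_preimage [OF continuous_assoc_proj assms])

text \<open>A restriction of a quotient map need not be a quotient map. Here it is, since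
  \<open>lb_over assoc U\<close> is open and \<open>pb_over P U \<times> UNIV\<close> is its full
  preimage.\<close>

lemma quotient_map_class_over:
  assumes "openin (mtop (pb_base P)) U"
  shows "quotient_map (prod_topology (subtopology (mtop (pb_total P)) (pb_over P U)) euclidean)
     (subtopology (lb_total assoc) (lb_over assoc U)) cls"
proof -
  have "quotient_map (subtopology (prod_topology (mtop (pb_total P)) euclidean) (pb_over P U \<times> UNIV))
     (subtopology (lb_total assoc) (lb_over assoc U)) cls"
    by (rule quotient_map_restriction [OF quotient_map_class])
      (use assms openin_over in \<open>auto simp: lb_over_def topspace_assoc pb_over_def\<close>)
  then show ?thesis
    by (simp add: subtopology_Times)
qed

section \<open>Induced charts\<close>

lemma assoc_chart_inv_eq: "assoc_chart_inv Q P \<kappa> U \<phi> (m, v) = cls (local_section U \<phi> m, v)"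
  by (simp add: assoc_chart_inv_def local_section_def)

text \<open>\<open>r\<close> is the section at its base point moved by
  \<open>snd (\<phi> r)\<close>, and \<open>class_act\<close> transfers that group element to the
  vector.\<close>

lemma assoc_chart_inv_class:
  assumes "principal_chart Q P U \<phi>" "r \<in> total_points" "pb_proj P r \<in> U"
  shows "assoc_chart_inv Q P \<kappa> U \<phi> (pb_proj P r, rep (snd (\<phi> r)) v) = cls (r, v)"
  by (simp add: assoc_chart_inv_eq act_local_section [OF assms]
      flip: class_act [OF local_section_closed [OF assms(1,3)] snd_chart_closed [OF assms]])

text \<open>The projection of the class recovers the base point; then both classes have the same
  section point, and \<open>class_inject\<close> recovers the vector.\<close>

lemma inj_assoc_chart_inv:
  assumes c: "principal_chart Q P U \<phi>"
  shows "inj_on (assoc_chart_inv Q P \<kappa> U \<phi>) (U \<times> UNIV)"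
proof (rule inj_onI, clarify)
  fix m v n w
  assume "m \<in> U" "n \<in> U" and
    eq: "assoc_chart_inv Q P \<kappa> U \<phi> (m, v) = assoc_chart_inv Q P \<kappa> U \<phi> (n, w)"
  then have "m = n"
    by (metis assoc_chart_inv_eq proj_class local_section_closed [OF c] proj_local_section [OF c])
  with eq \<open>m \<in> U\<close> show "m = n \<and> v = w"
    by (simp add: assoc_chart_inv_eq local_section_closed [OF c])
qed

text \<open>Replaces \<open>inv_into\<close> by a formula valid for every representative.\<close>

lemma assoc_chart_class:
  assumes "principal_chart Q P U \<phi>" "r \<in> total_points" "pb_proj P r \<in> U"
  shows "assoc_chart Q P \<kappa> U \<phi> (cls (r, v)) = (pb_proj P r, rep (snd (\<phi> r)) v)"
  unfolding assoc_chart_def assoc_chart_inv_class [OF assms, symmetric]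
  by (rule inv_into_f_f [OF inj_assoc_chart_inv]) (use assms in auto)

lemma assoc_chart_homeomorphic_maps:
  assumes c: "principal_chart Q P U \<phi>"
  shows "homeomorphic_maps (prod_topology (subtopology (mtop (pb_base P)) U) euclidean)
     (subtopology (lb_total assoc) (lb_over assoc U))
     (assoc_chart_inv Q P \<kappa> U \<phi>) (assoc_chart Q P \<kappa> U \<phi>)"
  unfolding homeomorphic_maps_def
proof (intro conjI ballI)
  let ?B = "subtopology (mtop (pb_base P)) U"
  let ?T = "subtopology (mtop (pb_total P)) (pb_over P U)"
  let ?E = "subtopology (lb_total assoc) (lb_over assoc U)"
  note q = quotient_map_class_over [OF openin_chart [OF c]]
  \<comment> \<open>The inverse chart is the quotient map after the local section in the first
    component.\<close>
  have "continuous_map (prod_topology ?B euclidean) (prod_topology ?T euclidean)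
    (\<lambda>z. ((local_section U \<phi> \<circ> fst) z, snd z))"
    by (rule continuous_map_pairedI
        [OF continuous_map_compose [OF continuous_map_fst continuous_local_section [OF c]]
          continuous_map_snd])
  from continuous_map_compose [OF this quotient_imp_continuous_map [OF q]]
  show "continuous_map (prod_topology ?B euclidean) ?E (assoc_chart_inv Q P \<kappa> U \<phi>)"
    by (rule continuous_map_eq) (auto simp: assoc_chart_inv_eq)
  have \<phi>: "continuous_map ?T (prod_topology ?B (mtop (lie_manifold Q))) \<phi>"
    using chart_homeomorphic_maps [OF c] by (simp add: homeomorphic_maps_def)
  have \<phi>': "continuous_map (prod_topology ?T (euclidean :: 'x topology)) ?B (fst \<circ> (\<phi> \<circ> fst))"
    "continuous_map (prod_topology ?T (euclidean :: 'x topology)) (mtop (lie_manifold Q)) (snd \<circ> (\<phi> \<circ> fst))"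
    by (rule continuous_map_compose [OF continuous_map_compose [OF continuous_map_fst \<phi>] continuous_map_fst],
        rule continuous_map_compose [OF continuous_map_compose [OF continuous_map_fst \<phi>] continuous_map_snd])
  \<comment> \<open>This map is the chart composed with the quotient map. Joint continuity of the
    representation enters through \<open>continuous_rep\<close>.\<close>
  have "continuous_map (prod_topology ?T euclidean) (prod_topology ?B euclidean)
    (\<lambda>z. ((fst \<circ> (\<phi> \<circ> fst)) z, rep ((snd \<circ> (\<phi> \<circ> fst)) z) (snd z)))"
    by (rule continuous_map_pairedI [OF \<phi>'(1) continuous_rep [OF \<phi>'(2) continuous_map_snd]])
  then have "continuous_map (prod_topology ?T euclidean) (prod_topology ?B euclidean)
    (assoc_chart Q P \<kappa> U \<phi> \<circ> cls)"
    by (rule continuous_map_eq)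
      (auto simp: assoc_chart_class [OF c] fst_chart [OF c] pb_over_def)
  then show "continuous_map ?E (prod_topology ?B euclidean) (assoc_chart Q P \<kappa> U \<phi>)"
    by (rule continuous_compose_quotient_map [OF q])
next
  fix z assume "z \<in> topspace (prod_topology (subtopology (mtop (pb_base P)) U) (euclidean :: 'x topology))"
  then show "assoc_chart Q P \<kappa> U \<phi> (assoc_chart_inv Q P \<kappa> U \<phi> z) = z"
    unfolding assoc_chart_def by (intro inv_into_f_f inj_assoc_chart_inv c) auto
next
  fix e assume "e \<in> topspace (subtopology (lb_total assoc) (lb_over assoc U))"
  then obtain r v where "r \<in> total_points" "pb_proj P r \<in> U" "e = cls (r, v)"
    by (auto simp: over_iff)
  then show "assoc_chart_inv Q P \<kappa> U \<phi> (assoc_chart Q P \<kappa> U \<phi> e) = e"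
    by (simp add: assoc_chart_class [OF c] assoc_chart_inv_class [OF c])
qed

text \<open>On the fibre through \<open>r\<close> the vector part of the chart is
  \<open>rep (snd (\<phi> r))\<close>, hence linear.\<close>

lemma linear_bundle_chart_assoc_chart:
  assumes c: "principal_chart Q P U \<phi>"
  shows "linear_bundle_chart smul assoc U (assoc_chart Q P \<kappa> U \<phi>)"
proof -
  have "snd (assoc_chart Q P \<kappa> U \<phi> (lb_add assoc e f)) =
      snd (assoc_chart Q P \<kappa> U \<phi> e) + snd (assoc_chart Q P \<kappa> U \<phi> f) \<and>
      snd (assoc_chart Q P \<kappa> U \<phi> (lb_scale assoc k e)) = smul k (snd (assoc_chart Q P \<kappa> U \<phi> e))"
    if m: "m \<in> U" and e: "e \<in> fibre assoc m" and f: "f \<in> fibre assoc m" for m e f k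
  proof -
    have "m \<in> points (pb_base P)"
      using m chart_domain [OF c] by blast
    then obtain r where "r \<in> total_points" "m = pb_proj P r"
        "fibre assoc m = range (\<lambda>v. cls (r, v))"
      by (rule fibre_induct)
    with that show ?thesis
      by (auto simp: assoc_chart_class [OF c] blinfun.add_right snd_chart_closed [OF c])
  qed
  moreover have "homeomorphic_map (subtopology (lb_total assoc) (lb_over assoc U))
       (prod_topology (subtopology (mtop (pb_base P)) U) euclidean) (assoc_chart Q P \<kappa> U \<phi>)"
    using assoc_chart_homeomorphic_maps [OF c] by (simp add: homeomorphic_maps_map)
  ultimately show ?thesis
    unfolding linear_bundle_chart_def
    by (auto simp: openin_chart [OF c] over_iff assoc_chart_class [OF c])
qed

section \<open>Transition functions\<close>

lemma strongly_continuous_transition_assoc_chart: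
  assumes c: "principal_chart Q P U \<phi>" and d: "principal_chart Q P V \<theta>"
  shows "strongly_continuous_transition smul assoc
    (U, assoc_chart Q P \<kappa> U \<phi>) (V, assoc_chart Q P \<kappa> V \<theta>)"
proof -
  define \<tau> where "\<tau> m = \<kappa> (snd (\<theta> (local_section U \<phi> m)))" for m
  let ?B = "subtopology (mtop (pb_base P)) (U \<inter> V)"
  have cl: "snd (\<theta> (local_section U \<phi> m)) \<in> carrier Q" if "m \<in> U \<inter> V" for m
    using that by (intro snd_chart_closed [OF d]) (auto simp: local_section [OF c])
  have "continuous_map ?B (mtop (pb_total P)) (local_section U \<phi>)"
    using continuous_local_section [OF c]
    by (meson continuous_map_from_subtopology_mono continuous_map_in_subtopology inf_le1)
  moreover have "local_section U \<phi> \<in> topspace ?B \<rightarrow> pb_over P V"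
    by (auto simp: local_section [OF c] pb_over_def)
  ultimately have "continuous_map ?B (subtopology (mtop (pb_total P)) (pb_over P V)) (local_section U \<phi>)"
    by (rule continuous_map_into_subtopology)
  moreover have "continuous_map (subtopology (mtop (pb_total P)) (pb_over P V))
      (prod_topology (subtopology (mtop (pb_base P)) V) (mtop (lie_manifold Q))) \<theta>"
    using chart_homeomorphic_maps [OF d] by (simp add: homeomorphic_maps_def)
  ultimately have "continuous_map ?B (mtop (lie_manifold Q)) (snd \<circ> (\<theta> \<circ> local_section U \<phi>))"
    by (rule continuous_map_compose [OF continuous_map_compose continuous_map_snd])
  then have "continuous_map ?B euclidean (\<lambda>m. rep ((snd \<circ> (\<theta> \<circ> local_section U \<phi>)) m) v)" for v
    by (rule continuous_rep) simp
  \<comment> \<open>Continuity into the strong operator topology is continuity of the evaluation at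
    each fixed vector \<open>v\<close>.\<close>
  then have "continuous_map ?B strong_operator_topology \<tau>"
    by (simp add: continuous_on_strong_operator_topo_iff_coordinatewise \<tau>_def)
  then have "continuous_map ?B (subtopology strong_operator_topology (Aut smul)) \<tau>"
    by (rule continuous_map_into_subtopology) (auto simp: \<tau>_def cl rep_Aut)
  moreover have "assoc_chart Q P \<kappa> V \<theta> (cls (r, v)) =
      (pb_proj P r, blinfun_apply (\<tau> (pb_proj P r)) (snd (assoc_chart Q P \<kappa> U \<phi> (cls (r, v)))))"
    if r: "r \<in> total_points" "pb_proj P r \<in> U" "pb_proj P r \<in> V" for r v
  proof -
    \<comment> \<open>Equivariance of \<open>\<theta>\<close>, applied to \<open>r\<close> as the
      translate of the section by \<open>snd (\<phi> r)\<close>. Multiplicativity of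
      \<open>rep\<close> then factors the chart over \<open>V\<close> as \<open>\<tau>\<close> after
      the chart over \<open>U\<close>.\<close>
    have "snd (\<theta> r) = snd (\<theta> (local_section U \<phi> (pb_proj P r))) \<otimes> snd (\<phi> r)"
      using r by (metis act_local_section [OF c] local_section(1,2) [OF c]
          snd_chart_act [OF d] snd_chart_closed [OF c])
    then show ?thesis
      using r by (simp add: assoc_chart_class [OF c] assoc_chart_class [OF d] \<tau>_def cl
          snd_chart_closed [OF c])
  qed
  ultimately show ?thesis
    unfolding strongly_continuous_transition_def by (auto simp: over_iff intro!: exI [of _ \<tau>])
qed

section \<open>Induced atlases and the Banach bundle\<close>

lemma principal_atlas_chart:
  assumes "principal_atlas Q P \<A>" "(U, \<phi>) \<in> \<A>"
  shows "principal_chart Q P U \<phi>"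
  using assms by (auto simp: principal_atlas_def)

lemma assoc_atlasE:
  assumes "principal_atlas Q P \<A>" "(U, \<psi>) \<in> assoc_atlas Q P \<kappa> \<A>"
  obtains \<phi> where "principal_chart Q P U \<phi>" "\<psi> = assoc_chart Q P \<kappa> U \<phi>"
  using assms principal_atlas_chart by (auto simp: assoc_atlas_def)

lemma strongly_continuous_transition_assoc_atlas:
  assumes "principal_atlas Q P \<A>" "principal_atlas Q P \<B>"
    and "c \<in> assoc_atlas Q P \<kappa> \<A>" "d \<in> assoc_atlas Q P \<kappa> \<B>"
  shows "strongly_continuous_transition smul assoc c d"
proof -
  obtain U \<psi> V \<theta> where "c = (U, \<psi>)" "d = (V, \<theta>)"
    by (metis surj_pair)
  then show ?thesis
    using assms by (metis assoc_atlasE strongly_continuous_transition_assoc_chart)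
qed

lemma continuous_linear_bundle_assoc:
  assumes \<A>: "principal_atlas Q P \<A>"
  shows "continuous_linear_bundle smul assoc (assoc_atlas Q P \<kappa> \<A>)"
proof -
  have "(\<Union>(U, \<psi>) \<in> assoc_atlas Q P \<kappa> \<A>. U) = (\<Union>(U, \<phi>) \<in> \<A>. U)"
    unfolding assoc_atlas_def by blast
  also have "\<dots> = points (pb_base P)"
    using \<A> by (simp add: principal_atlas_def)
  finally have cover: "(\<Union>(U, \<psi>) \<in> assoc_atlas Q P \<kappa> \<A>. U) = points (pb_base P)" .
  have "linear_bundle_chart smul assoc U \<psi>" if "(U, \<psi>) \<in> assoc_atlas Q P \<kappa> \<A>" for U \<psi>
    using assoc_atlasE [OF \<A> that] linear_bundle_chart_assoc_chart by metis
  then have "\<forall>(U, \<psi>) \<in> assoc_atlas Q P \<kappa> \<A>. linear_bundle_chart smul assoc U \<psi>"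
    by blast
  with cover show ?thesis
    unfolding continuous_linear_bundle_def lb_base_assoc
    by - (intro conjI; (assumption | intro ballI continuous_assoc_proj vector_space_on_fibre
        strongly_continuous_transition_assoc_atlas [OF \<A> \<A>]))
qed

lemma continuous_banach_bundle_assoc:
  assumes \<A>: "principal_atlas Q P \<A>"
  shows "continuous_banach_bundle smul assoc assoc_norm (assoc_atlas Q P \<kappa> \<A>)"
proof -
  have "norm (snd (\<psi> e)) = assoc_norm e"
    if chart: "(U, \<psi>) \<in> assoc_atlas Q P \<kappa> \<A>" and e: "e \<in> lb_over assoc U" for U \<psi> e
  proof -
    obtain \<phi> where c: "principal_chart Q P U \<phi>" "\<psi> = assoc_chart Q P \<kappa> U \<phi>"
      using assoc_atlasE [OF \<A> chart] .
    then show ?thesis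
      using e by (auto simp: over_iff assoc_chart_class snd_chart_closed)
  qed
  then have "\<forall>(U, \<psi>) \<in> assoc_atlas Q P \<kappa> \<A>. \<forall>e\<in>lb_over assoc U. norm (snd (\<psi> e)) = assoc_norm e"
    by blast
  then show ?thesis
    unfolding continuous_banach_bundle_def lb_base_assoc
    by - (intro conjI; (assumption | intro ballI continuous_linear_bundle_assoc [OF \<A>]
        norm_on_fibre continuous_assoc_norm))
qed

text \<open>The homeomorphism and compatibility clauses do not involve \<open>B\<close>, so the
  Banach and Hilbert cases share them and differ only in the bundle property of each atlas.\<close>

lemma canonicallyI:
  assumes B: "\<And>\<A>. principal_atlas Q P \<A> \<Longrightarrow> B (assoc_atlas Q P \<kappa> \<A>)"
  shows "canonically Q P smul \<kappa> B"
proof -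
  have "\<forall>(U, \<phi>) \<in> \<A>. homeomorphic_maps
     (prod_topology (subtopology (lb_base assoc) U) euclidean)
     (subtopology (lb_total assoc) (lb_over assoc U))
     (assoc_chart_inv Q P \<kappa> U \<phi>) (assoc_chart Q P \<kappa> U \<phi>)" if "principal_atlas Q P \<A>" for \<A>
    unfolding lb_base_assoc
    using principal_atlas_chart [OF that] assoc_chart_homeomorphic_maps by blast
  moreover have "C0_compatible smul assoc (assoc_atlas Q P \<kappa> \<A>) (assoc_atlas Q P \<kappa> \<B>)"
    if "principal_atlas Q P \<A>" "principal_atlas Q P \<B>" for \<A> \<B>
    unfolding C0_compatible_def Un_iff
    using that strongly_continuous_transition_assoc_atlas by blast
  ultimately show ?thesis
    unfolding canonically_def Let_def using B by blast
qed

end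

section \<open>Conjugation and scalar products\<close>

lemma conjugate_mult: "conjugate (a * b) = conjugate a * conjugate b"
  \<comment> \<open>The scalar field is abstract: the rule follows from the formula
    \<open>(norm a)\<^sup>2 / a\<close> and multiplicativity of the norm.\<close>
  by (simp add: conjugate_def norm_mult power_mult_distrib)

lemma conjugate_of_real [simp]: "conjugate (of_real t) = of_real t"
  by (simp add: conjugate_def power2_eq_square)

lemma norm_conjugate [simp]: "norm (conjugate a) = norm a"
  by (simp add: conjugate_def norm_divide norm_power power2_eq_square del: of_real_power of_real_mult)

lemma conjugate_mult_self: "conjugate a * a = of_real ((norm a)\<^sup>2)"
  by (simp add: conjugate_def)

locale hilbert =
  fixes smul :: "'k::real_normed_field \<Rightarrow> 'x::banach \<Rightarrow> 'x"
    and ip :: "'x \<Rightarrow> 'x \<Rightarrow> 'k"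
  assumes hilbert: "hilbert_space smul ip"
begin

lemma banach_space_smul: "banach_space smul"
  using hilbert unfolding hilbert_space_def by (rule conjunct1)

lemma smul_of_real: "smul (of_real t) v = t *\<^sub>R v"
  using banach_space_smul by (simp add: banach_space_def)

lemma ip_add_right: "ip u (v + w) = ip u v + ip u w"
  and ip_add_left: "ip (u + v) w = ip u w + ip v w"
  and ip_smul_right: "ip u (smul c v) = c * ip u v"
  and ip_self: "ip v v = of_real ((norm v)\<^sup>2)"
  and ip_commute: "ip v u = conjugate (ip u v)"
  using hilbert unfolding hilbert_space_def by iprover+

lemma ip_smul_left: "ip (smul c u) v = conjugate c * ip u v"
  \<comment> \<open>Both products are rewritten with swapped arguments, so that linearity on the
    right applies under \<open>conjugate\<close>.\<close>
  by (subst (1 2) ip_commute) (simp add: ip_smul_right conjugate_mult)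

lemma ip_scaleR: "ip u (t *\<^sub>R v) = t *\<^sub>R ip u v" "ip (t *\<^sub>R u) v = t *\<^sub>R ip u v"
  by (simp_all add: ip_smul_right ip_smul_left scaleR_conv_of_real flip: smul_of_real)

text \<open>Remove from \<open>u\<close> its component along \<open>v\<close>; the squared norm of
  the remainder is nonnegative.\<close>

lemma Cauchy_Schwarz: "norm (ip u v) \<le> norm u * norm v"
proof (cases "v = 0")
  case True
  have "ip u 0 = 0"
    using ip_scaleR(1) [of u 0 0] by simp
  with True show ?thesis
    by simp
next
  case False
  define a where "a = ip u v"
  \<comment> \<open>This coefficient makes \<open>w\<close> below orthogonal to \<open>v\<close>. It
    divides by the squared norm of \<open>v\<close>, hence the separate case
    \<open>v = 0\<close>.\<close>
  define c where "c = - conjugate a / of_real ((norm v)\<^sup>2)"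
  define s where "s = (norm a)\<^sup>2 / (norm v)\<^sup>2"
  define w where "w = u + smul c v"
  have ca: "c * a = of_real (- s)"
    by (simp add: c_def s_def conjugate_mult_self)
  have "norm c = norm a / (norm v)\<^sup>2"
    by (simp add: c_def norm_divide norm_power)
  then have cc: "(norm c)\<^sup>2 * (norm v)\<^sup>2 = s"
    using False by (simp add: s_def field_simps power2_eq_square)
  have "ip w w = ip u u + c * a + conjugate c * ip v u + conjugate c * c * ip v v"
    by (simp add: w_def ip_add_left ip_add_right ip_smul_left ip_smul_right a_def algebra_simps)
  also have "conjugate c * ip v u = conjugate (c * a)"
    by (simp add: conjugate_mult a_def ip_commute [of v u])
  also have "conjugate c * c * ip v v = of_real ((norm c)\<^sup>2 * (norm v)\<^sup>2)"
    unfolding conjugate_mult_self ip_self by simp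
  \<comment> \<open>The two mixed terms contribute \<open>- s\<close> each, being real and so fixed
    by conjugation, and the last term contributes \<open>s\<close>.\<close>
  finally have "of_real ((norm w)\<^sup>2) = (of_real ((norm u)\<^sup>2 - s) :: 'k)"
    unfolding ca cc ip_self conjugate_of_real by simp
  then have "(norm w)\<^sup>2 = (norm u)\<^sup>2 - s"
    unfolding of_real_eq_iff .
  then have "s \<le> (norm u)\<^sup>2"
    by (metis diff_ge_0_iff_ge zero_le_power2)
  then have "(norm a)\<^sup>2 \<le> (norm u * norm v)\<^sup>2"
    using False by (simp add: s_def divide_le_eq power_mult_distrib)
  then show ?thesis
    unfolding a_def by (rule power2_le_imp_le) simp
qed

text \<open>Over the reals the product is bilinear, because conjugation fixes real scalars;
  Cauchy-Schwarz supplies the bound \<open>1\<close>. Joint continuity follows.\<close>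

lemma bounded_bilinear_ip: "bounded_bilinear ip"
  by unfold_locales
    (auto simp: ip_add_left ip_add_right ip_scaleR intro!: exI [of _ 1] Cauchy_Schwarz)

lemma continuous_ip:
  assumes "continuous_map X euclidean f" "continuous_map X euclidean g"
  shows "continuous_map X euclidean (\<lambda>x. ip (f x) (g x))"
proof -
  have "continuous_on UNIV (\<lambda>z. ip (fst z) (snd z))"
    by (intro bounded_bilinear.continuous_on [OF bounded_bilinear_ip] continuous_intros)
  then have "continuous_map (prod_topology euclidean euclidean) euclidean (\<lambda>z. ip (fst z) (snd z))"
    by simp
  from continuous_map_compose [OF continuous_map_pairedI [OF assms] this]
  show ?thesis
    by (simp add: o_def)
qed

text \<open>The norm is recovered from the product by \<open>ip_self\<close>. Through the
  \<open>sublocale\<close> below, everything shown for isometric representations passes to unitary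
  ones.\<close>

lemma isometric_if_unitary:
  assumes "unitary_representation Q smul ip \<kappa>"
  shows "isometric_representation Q smul \<kappa>"
proof -
  have "norm (blinfun_apply (\<kappa> g) v) = norm v" if "g \<in> carrier Q" for g v
  proof -
    have "ip (blinfun_apply (\<kappa> g) v) (blinfun_apply (\<kappa> g) v) = ip v v"
      using assms that by (simp add: unitary_representation_def)
    then show ?thesis
      unfolding ip_self of_real_eq_iff by simp
  qed
  with assms show ?thesis
    by (simp add: unitary_representation_def isometric_representation_def)
qed

end

section \<open>Unitary representations and the Hilbert bundle\<close>

locale unitary_principal_representation = hilbert smul ip
  for smul :: "'k::real_normed_field \<Rightarrow> 'x::banach \<Rightarrow> 'x" and ip +
  fixes Q :: "'q lie_structure" (structure)
    and P :: "('q, 'm, 'r) principal_structure"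
    and \<kappa> :: "'q \<Rightarrow> 'x \<Rightarrow>\<^sub>L 'x"
  assumes principal: "principal_bundle Q P"
    and unitary: "unitary_representation Q smul ip \<kappa>"
begin

sublocale principal_representation Q P smul \<kappa>
  by unfold_locales (fact principal banach_space_smul isometric_if_unitary [OF unitary])+

lemma ip_rep [simp]: "g \<in> carrier Q \<Longrightarrow> ip (rep g v) (rep g w) = ip v w"
  using unitary by (simp add: unitary_representation_def)

text \<open>Pairs over a common point involve the same group element, so unitarity leaves a single
  value for \<open>the_elem\<close>.\<close>

lemma scalar_product_class [simp]:
  assumes "r \<in> total_points"
  shows "assoc_scalar_product ip (cls (r, v)) (cls (r, w)) = ip v w"
proof -
  have "ip x y = ip v w" if "(s, x) \<in> cls (r, v) \<and> (s, y) \<in> cls (r, w)" for s x y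
    using that unfolding class_common_act [OF assms] by auto
  then have "{ip x y |s x y. (s, x) \<in> cls (r, v) \<and> (s, y) \<in> cls (r, w)} = {ip v w}"
    using self_mem_class [OF assms] by blast
  then show ?thesis
    by (simp add: assoc_scalar_product_def)
qed

lemma scalar_product_on_fibre:
  assumes "m \<in> points (pb_base P)"
  shows "scalar_product_on (fibre assoc m) (lb_add assoc) (lb_scale assoc) (lb_zero assoc m)
    (assoc_scalar_product ip)"
proof -
  obtain r where r: "r \<in> total_points" "fibre assoc m = range (\<lambda>v. cls (r, v))"
      "lb_zero assoc m = cls (r, 0)"
    using assms by (rule fibre_induct)
  have "\<exists>t>0. ip v v = of_real t" if "v \<noteq> 0" for v
    using that by (intro exI [of _ "(norm v)\<^sup>2"]) (simp add: ip_self)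
  with r show ?thesis
    by (auto simp: scalar_product_on_def ip_add_left ip_add_right ip_smul_right simp flip: ip_commute)
qed

text \<open>On one fibre the chart applies the same unitary map \<open>rep (snd (\<phi> r))\<close>
  to both vectors.\<close>

lemma ip_assoc_chart:
  assumes c: "principal_chart Q P U \<phi>" and m: "m \<in> U"
    and "e \<in> fibre assoc m" "f \<in> fibre assoc m"
  shows "ip (snd (assoc_chart Q P \<kappa> U \<phi> e)) (snd (assoc_chart Q P \<kappa> U \<phi> f)) =
    assoc_scalar_product ip e f"
proof -
  have "m \<in> points (pb_base P)"
    using m chart_domain [OF c] by blast
  then obtain r where "r \<in> total_points" "m = pb_proj P r"
      "fibre assoc m = range (\<lambda>v. cls (r, v))"
    by (rule fibre_induct)
  with assms show ?thesis
    by (auto simp: assoc_chart_class [OF c] snd_chart_closed [OF c])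
qed

text \<open>The domain is a subspace of a product of two quotients, so the universal property of
  \<open>cls\<close> does not apply directly as it does for the norm. Continuity is glued instead
  from open pieces over chart domains, where the product is \<open>ip\<close> of the vector parts of
  the chart.\<close>

lemma continuous_scalar_product:
  "continuous_map
     (subtopology (prod_topology (lb_total assoc) (lb_total assoc))
       {(e, f). lb_proj assoc e = lb_proj assoc f})
     euclidean (\<lambda>(e, f). assoc_scalar_product ip e f)"
    (is "continuous_map ?X _ _")
proof (rule pasting_lemma)
  let ?I = "{(U, \<phi>). principal_chart Q P U \<phi>}"
  let ?W = "\<lambda>(U, \<phi>). {z \<in> topspace ?X. lb_proj assoc (fst z) \<in> U}"
  let ?f = "\<lambda>(U, \<phi>) z. ip (snd (assoc_chart Q P \<kappa> U \<phi> (fst z))) (snd (assoc_chart Q P \<kappa> U \<phi> (snd z)))"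
  have fst: "continuous_map ?X (lb_total assoc) fst" and snd: "continuous_map ?X (lb_total assoc) snd"
    by (simp_all add: continuous_map_from_subtopology continuous_map_fst continuous_map_snd)
  have eq: "?f i z = assoc_scalar_product ip (fst z) (snd z)" if "i \<in> ?I" "z \<in> ?W i" for i z
    using that by (auto simp: lb_over_def intro!: ip_assoc_chart)
  show "openin ?X (?W i)" if mem: "i \<in> ?I" for i
  proof -
    obtain U \<phi> where i: "i = (U, \<phi>)" "principal_chart Q P U \<phi>"
      using mem by auto
    have "continuous_map ?X (mtop (pb_base P)) (lb_proj assoc \<circ> fst)"
      by (rule continuous_map_compose [OF fst continuous_assoc_proj])
    from openin_continuous_map_preimage [OF this openin_chart [OF i(2)]]
    show ?thesis
      by (simp add: i)
  qed
  show "continuous_map (subtopology ?X (?W i)) euclidean (?f i)" if mem: "i \<in> ?I" for i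
  proof -
    obtain U \<phi> where i: "i = (U, \<phi>)" and c: "principal_chart Q P U \<phi>"
      using mem by auto
    let ?Y = "subtopology ?X (?W i)"
    have \<psi>: "continuous_map (subtopology (lb_total assoc) (lb_over assoc U)) euclidean
        (snd \<circ> assoc_chart Q P \<kappa> U \<phi>)"
      using assoc_chart_homeomorphic_maps [OF c]
      by (auto simp: homeomorphic_maps_def intro: continuous_map_compose continuous_map_snd)
    have "continuous_map ?Y (subtopology (lb_total assoc) (lb_over assoc U)) fst"
      by (rule continuous_map_into_subtopology [OF continuous_map_from_subtopology [OF fst]])
        (auto simp: i lb_over_def)
    \<comment> \<open>In \<open>?X\<close> both components have the same projection, so the second
      one lies over \<open>U\<close> as well.\<close>
    moreover have "continuous_map ?Y (subtopology (lb_total assoc) (lb_over assoc U)) snd"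
      by (rule continuous_map_into_subtopology [OF continuous_map_from_subtopology [OF snd]])
        (auto simp: i lb_over_def)
    ultimately show ?thesis
      using continuous_ip [OF continuous_map_compose [OF _ \<psi>] continuous_map_compose [OF _ \<psi>]]
      by (simp add: i o_def)
  qed
  \<comment> \<open>The local expressions agree on overlaps because each equals the globally defined
    product.\<close>
  show "?f i z = ?f j z" if i: "i \<in> ?I" and j: "j \<in> ?I" and z: "z \<in> topspace ?X \<inter> ?W i \<inter> ?W j" for i j z
  proof -
    have "?f i z = assoc_scalar_product ip (fst z) (snd z)"
      by (rule eq [OF i IntD2 [OF IntD1 [OF z]]])
    also have "\<dots> = ?f j z"
      by (rule eq [OF j IntD2 [OF z], symmetric])
    finally show ?thesis .
  qed
  show "\<exists>j. j \<in> ?I \<and> z \<in> ?W j \<and> (\<lambda>(e, f). assoc_scalar_product ip e f) z = ?f j z"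
    if "z \<in> topspace ?X" for z
  proof -
    have "fst z \<in> topspace (lb_total assoc)"
      using that by auto
    then have "lb_proj assoc (fst z) \<in> points (pb_base P)"
      using continuous_map_image_subset_topspace [OF continuous_assoc_proj] by blast
    then obtain U \<phi> where "principal_chart Q P U \<phi>" "lb_proj assoc (fst z) \<in> U"
      by (rule ex_chart)
    then have *: "(U, \<phi>) \<in> ?I" "z \<in> ?W (U, \<phi>)"
      using that by simp_all
    then show ?thesis
      using eq [OF *, symmetric] unfolding case_prod_beta by blast
  qed
qed

lemma continuous_hilbert_bundle_assoc:
  assumes \<A>: "principal_atlas Q P \<A>"
  shows "continuous_hilbert_bundle smul ip assoc (assoc_scalar_product ip) (assoc_atlas Q P \<kappa> \<A>)"
proof -
  have "ip (snd (\<psi> e)) (snd (\<psi> f)) = assoc_scalar_product ip e f"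
    if "(U, \<psi>) \<in> assoc_atlas Q P \<kappa> \<A>" "m \<in> U" "e \<in> fibre assoc m" "f \<in> fibre assoc m"
    for U \<psi> m e f
    using assoc_atlasE [OF \<A> that(1)] ip_assoc_chart that(2-4) by metis
  then have "\<forall>(U, \<psi>) \<in> assoc_atlas Q P \<kappa> \<A>. \<forall>m\<in>U. \<forall>e\<in>fibre assoc m. \<forall>f\<in>fibre assoc m.
      ip (snd (\<psi> e)) (snd (\<psi> f)) = assoc_scalar_product ip e f"
    by blast
  then show ?thesis
    unfolding continuous_hilbert_bundle_def lb_base_assoc
    by - (intro conjI; (assumption | intro ballI continuous_linear_bundle_assoc [OF \<A>]
        scalar_product_on_fibre continuous_scalar_product))
qed

end

theorem theorem4:
  fixes Q :: "'q lie_structure"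
    and P :: "('q, 'm, 'r) principal_structure"
    and smul :: "'k::real_normed_field \<Rightarrow> 'x::banach \<Rightarrow> 'x"
    and \<kappa> :: "'q \<Rightarrow> 'x \<Rightarrow>\<^sub>L 'x"
  assumes "lie_group Q"
    and "principal_bundle Q P"
  shows
    "(banach_space smul \<and> isometric_representation Q smul \<kappa> \<longrightarrow>
        (\<forall>r\<in>points (pb_total P). \<forall>v.
           lb_proj (assoc_bundle Q P smul \<kappa>) (assoc_class Q P \<kappa> (r, v)) = pb_proj P r \<and>
           assoc_norm (assoc_class Q P \<kappa> (r, v)) = norm v) \<and>
        canonically Q P smul \<kappa>
          (continuous_banach_bundle smul (assoc_bundle Q P smul \<kappa>) assoc_norm)) \<and>
     (\<forall>ip. hilbert_space smul ip \<and> unitary_representation Q smul ip \<kappa> \<longrightarrow>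
        (\<forall>r\<in>points (pb_total P). \<forall>v w.
           lb_proj (assoc_bundle Q P smul \<kappa>) (assoc_class Q P \<kappa> (r, v)) = pb_proj P r \<and>
           assoc_scalar_product ip (assoc_class Q P \<kappa> (r, v)) (assoc_class Q P \<kappa> (r, w)) = ip v w) \<and>
        canonically Q P smul \<kappa>
          (continuous_hilbert_bundle smul ip (assoc_bundle Q P smul \<kappa>) (assoc_scalar_product ip)))"
proof (intro conjI impI allI; elim conjE)
  assume "banach_space smul" "isometric_representation Q smul \<kappa>"
  then interpret principal_representation Q P smul \<kappa>
    using assms(2) by unfold_locales
  show "\<forall>r\<in>points (pb_total P). \<forall>v.
      lb_proj (assoc_bundle Q P smul \<kappa>) (assoc_class Q P \<kappa> (r, v)) = pb_proj P r \<and>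
      assoc_norm (assoc_class Q P \<kappa> (r, v)) = norm v"
    by simp
  show "canonically Q P smul \<kappa>
      (continuous_banach_bundle smul (assoc_bundle Q P smul \<kappa>) assoc_norm)"
    by (intro canonicallyI continuous_banach_bundle_assoc)
next
  fix ip
  assume "hilbert_space smul ip" "unitary_representation Q smul ip \<kappa>"
  then interpret unitary_principal_representation smul ip Q P \<kappa>
    using assms(2) by unfold_locales
  show "\<forall>r\<in>points (pb_total P). \<forall>v w.
      lb_proj (assoc_bundle Q P smul \<kappa>) (assoc_class Q P \<kappa> (r, v)) = pb_proj P r \<and>
      assoc_scalar_product ip (assoc_class Q P \<kappa> (r, v)) (assoc_class Q P \<kappa> (r, w)) = ip v w"
    by simp
  show "canonically Q P smul \<kappa>
      (continuous_hilbert_bundle smul ip (assoc_bundle Q P smul \<kappa>) (assoc_scalar_product ip))"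
    by (intro canonicallyI continuous_hilbert_bundle_assoc)
qed

end
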